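(* Let $G$ be a group with a non-elementary action by homeomorphisms on a dendrite $X$. Then $X$ contains a canonical compact $G$-set which is a $G$-boundary in Furstenberg's sense.
   Context: A continuum is a non-empty connected compact metrisable space. A dendrite is a locally connected continuum containing no simple closed curve. An action of a group $G$ by homeomorphisms on a dendrite $X$ is elementary if $G$ fixes a point of $X$ or preserves (setwise) a pair of points of $X$; otherwise it is non-elementary. A compact $G$-set in $X$ is a compact $G$-invariant subset of $X$, with the restricted $G$-action. For a compact space $Y$ with a $G$-action by homeomorphisms, $\mathrm{Prob}(Y)$ is the space of Borel probability measures on $Y$ with the weak-* topology. The action is strongly proximal if the closure of every $G$-orbit in $\mathrm{Prob}(Y)$ contains a Dirac mass. A $G$-boundary in the sense of Furstenberg is a compact $G$-space that is both minimal (it has no proper non-empty closed $G$-invariant subset) and strongly proximal. *)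

theory Defs
  imports "HOL-Analysis.Analysis" "HOL-Algebra.Group_Action" "HOL-Probability.Giry_Monad"
begin

text \<open>Metrisable spaces are subsets of a type of class \<^class>\<open>metric_space\<close>, with the subspace
  topology.\<close>

definition continuum :: "'a::metric_space set \<Rightarrow> bool" where
  "continuum X \<longleftrightarrow> X \<noteq> {} \<and> connected X \<and> compact X"

definition dendrite :: "'a::metric_space set \<Rightarrow> bool" where
  "dendrite X \<longleftrightarrow> continuum X \<and> locally connected X \<and>
     \<not> (\<exists>\<gamma>. simple_path \<gamma> \<and> pathfinish \<gamma> = pathstart \<gamma> \<and> path_image \<gamma> \<subseteq> X)"

definition acts_by_homeomorphisms ::
  "('g, 'm) monoid_scheme \<Rightarrow> 'a::metric_space set \<Rightarrow> ('g \<Rightarrow> 'a \<Rightarrow> 'a) \<Rightarrow> bool" where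
  "acts_by_homeomorphisms G X \<phi> \<longleftrightarrow> group_action G X \<phi> \<and>
     (\<forall>g\<in>carrier G. \<exists>h. homeomorphism X X (\<phi> g) h)"

definition elementary_action ::
  "('g, 'm) monoid_scheme \<Rightarrow> 'a set \<Rightarrow> ('g \<Rightarrow> 'a \<Rightarrow> 'a) \<Rightarrow> bool" where
  "elementary_action G X \<phi> \<longleftrightarrow>
     (\<exists>x\<in>X. \<forall>g\<in>carrier G. \<phi> g x = x) \<or>
     (\<exists>x\<in>X. \<exists>y\<in>X. x \<noteq> y \<and> (\<forall>g\<in>carrier G. \<phi> g ` {x, y} = {x, y}))"

definition invariant_set ::
  "('g, 'm) monoid_scheme \<Rightarrow> ('g \<Rightarrow> 'a \<Rightarrow> 'a) \<Rightarrow> 'a set \<Rightarrow> bool" where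
  "invariant_set G \<phi> K \<longleftrightarrow> (\<forall>g\<in>carrier G. \<phi> g ` K = K)"

definition compact_G_set ::
  "('g, 'm) monoid_scheme \<Rightarrow> 'a::metric_space set \<Rightarrow> ('g \<Rightarrow> 'a \<Rightarrow> 'a) \<Rightarrow> 'a set \<Rightarrow> bool" where
  "compact_G_set G X \<phi> K \<longleftrightarrow> K \<subseteq> X \<and> compact K \<and> invariant_set G \<phi> K"

text \<open>The bijections in \<^const>\<open>group_action\<close> are extensional, so each map must be cut down
  with \<^const>\<open>restrict\<close> to give an action on the subset.\<close>

definition restricted_action :: "('g \<Rightarrow> 'a \<Rightarrow> 'a) \<Rightarrow> 'a set \<Rightarrow> 'g \<Rightarrow> 'a \<Rightarrow> 'a" where
  "restricted_action \<phi> K g = restrict (\<phi> g) K"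

abbreviation borel_on :: "'a::topological_space set \<Rightarrow> 'a measure" where
  "borel_on Y \<equiv> restrict_space borel Y"

definition Prob :: "'a::metric_space set \<Rightarrow> 'a measure set" where
  "Prob Y = space (prob_algebra (borel_on Y))"

definition weak_star_topology :: "'a::metric_space set \<Rightarrow> 'a measure topology" where
  "weak_star_topology Y = topology_generated_by
     {{\<mu> \<in> Prob Y. (\<integral>x. f x \<partial>\<mu>) \<in> U} | (f :: 'a \<Rightarrow> real) U. continuous_on Y f \<and> open U}"

definition Prob_action ::
  "'a::metric_space set \<Rightarrow> ('g \<Rightarrow> 'a \<Rightarrow> 'a) \<Rightarrow> 'g \<Rightarrow> 'a measure \<Rightarrow> 'a measure" where
  "Prob_action Y \<phi> g \<mu> = distr \<mu> (borel_on Y) (\<phi> g)"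

definition strongly_proximal ::
  "('g, 'm) monoid_scheme \<Rightarrow> 'a::metric_space set \<Rightarrow> ('g \<Rightarrow> 'a \<Rightarrow> 'a) \<Rightarrow> bool" where
  "strongly_proximal G Y \<phi> \<longleftrightarrow>
     (\<forall>\<mu>\<in>Prob Y. \<exists>y\<in>Y. return (borel_on Y) y \<in>
        weak_star_topology Y closure_of orbit G (Prob_action Y \<phi>) \<mu>)"

definition minimal_action ::
  "('g, 'm) monoid_scheme \<Rightarrow> 'a::metric_space set \<Rightarrow> ('g \<Rightarrow> 'a \<Rightarrow> 'a) \<Rightarrow> bool" where
  "minimal_action G Y \<phi> \<longleftrightarrow>
     (\<forall>C. closedin (top_of_set Y) C \<and> invariant_set G \<phi> C \<longrightarrow> C = {} \<or> C = Y)"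

text \<open>Non-emptiness is explicit because the empty space is vacuously minimal and strongly
  proximal.\<close>

definition G_boundary ::
  "('g, 'm) monoid_scheme \<Rightarrow> 'a::metric_space set \<Rightarrow> ('g \<Rightarrow> 'a \<Rightarrow> 'a) \<Rightarrow> bool" where
  "G_boundary G Y \<phi> \<longleftrightarrow> Y \<noteq> {} \<and> compact Y \<and> acts_by_homeomorphisms G Y \<phi> \<and>
     minimal_action G Y \<phi> \<and> strongly_proximal G Y \<phi>"

end

theory Submission
  imports Defs "HOL-Real_Asymp.Real_Asymp"
begin

text \<open>
  The proof has a topological half, which replaces the dendrite by two properties of its subcontinua,
  and a dynamical half, which works with these two properties only.

  Topology. The intersection of two subcontinua of a dendrite is connected
  (\<open>dendrite_connected_Int\<close>). A locally connected continuum is locally path connected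
  (\<open>compact_locally_connected_imp_locally_path_connected\<close>), so a subcontinuum that misses a point \<open>z\<close> of an
  arc joining two of its points leaves room for a path between these points that avoids \<open>z\<close>, and the
  arc and the path together contain a simple closed curve. Hence a subcontinuum contains every arc
  whose ends lie in it, and arcs show that intersections are connected. This property
  alone, together with local connectedness, makes the continuum behave like a tree: pairwise
  intersecting subcontinua have a common point (\<open>helly\<close>), each component of the complement of a
  subcontinuum is attached to it at a single point (\<open>component_attached_at_one_point\<close>), and the
  diameters of pairwise disjoint connected open sets tend to zero (\<open>disjoint_connected_sets_null\<close>).

  Dynamics. Since there is no fixed point, any two non-empty invariant subcontinua meet, so there is a
  smallest one, the core. Call a component of \<open>X - {c}\<close> a branch at \<open>c\<close>. If a branch \<open>B\<close> meets the core,
  some group element maps \<open>X - B\<close> into \<open>B\<close> (\<open>flip_branch\<close>): otherwise the translates of \<open>X - B\<close> would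
  meet pairwise, and by Helly's theorem their intersection would be an invariant subcontinuum disjoint
  from \<open>B\<close>. The core has a point \<open>m\<close> at which three branches meet the core (\<open>core_ramifies\<close>), for
  otherwise the core would be an arc and its two ends would be preserved. Playing ping-pong with the
  flips of these three branches gives a branch \<open>B\<close> with infinitely many pairwise disjoint translates.
  Their diameters tend to zero, and a flip carries \<open>X - B\<close> into them, so \<open>X - B\<close> can be
  mapped to sets of arbitrarily small diameter (\<open>contraction_of_ramification\<close>); the same then holds for
  the complement of every translate of \<open>B\<close>.

  These contractions give everything. Two points lie outside one of three disjoint translates of
  \<open>B\<close>, so they can be brought arbitrarily close; hence any two non-empty compact invariant sets meet,
  and the intersection \<open>K\<close> of all such sets is the only minimal one. Given a probability measure on \<open>K\<close>,
  one of the disjoint translates of \<open>B\<close> has small measure, and squeezing its complement moves almost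
  all of the mass into a small ball; a limit of the centres of these balls carries a Dirac mass in
  the orbit closure (\<open>strongly_proximal_restricted\<close>).
\<close>

section \<open>Locally connected compacta are locally path connected\<close>

text \<open>
  The Lebesgue number of a cover of \<open>X\<close> by relatively connected open sets of diameter below \<open>\<epsilon>\<close>.
\<close>

lemma uniformly_locally_connected:
  fixes X :: "'a::metric_space set"
  assumes "compact X" "locally connected X" "\<epsilon> > 0"
  obtains \<delta> where "\<delta> > 0"
    "\<And>x y. x \<in> X \<Longrightarrow> y \<in> X \<Longrightarrow> dist x y < \<delta> \<Longrightarrow>
       \<exists>C. connected C \<and> C \<subseteq> X \<and> x \<in> C \<and> y \<in> C \<and> (\<forall>z\<in>C. dist x z < \<epsilon>)"
proof -
  define \<G> where "\<G> = {W. open W \<and> connected (X \<inter> W) \<and> (\<forall>u\<in>X \<inter> W. \<forall>v\<in>X \<inter> W. dist u v < \<epsilon>)}"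
  have "X \<subseteq> \<Union>\<G>"
  proof
    fix x assume x: "x \<in> X"
    have "openin (top_of_set X) (X \<inter> ball x (\<epsilon>/2))" "x \<in> X \<inter> ball x (\<epsilon>/2)"
      using x \<open>\<epsilon> > 0\<close> by auto
    then obtain U where U: "openin (top_of_set X) U" "connected U" "x \<in> U" "U \<subseteq> X \<inter> ball x (\<epsilon>/2)"
      using \<open>locally connected X\<close> unfolding locally_connected by meson
    then obtain W where W: "open W" "U = X \<inter> W"
      by (auto simp: openin_open)
    have "dist u v < \<epsilon>" if "u \<in> U" "v \<in> U" for u v
    proof -
      have "dist x u < \<epsilon>/2" "dist x v < \<epsilon>/2"
        using U(4) that by auto
      then show ?thesis
        using dist_triangle_half_r[of x u \<epsilon> v] by simp
    qed
    then have "W \<in> \<G>"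
      using W U by (auto simp: \<G>_def)
    then show "x \<in> \<Union>\<G>" using U(3) W by auto
  qed
  moreover have "open W" if "W \<in> \<G>" for W
    using that unfolding \<G>_def by simp
  ultimately obtain \<delta> where d: "0 < \<delta>" "\<And>x. x \<in> X \<Longrightarrow> \<exists>G \<in> \<G>. ball x \<delta> \<subseteq> G"
    using Heine_Borel_lemma[OF \<open>compact X\<close>, of \<G>] by metis
  show ?thesis
  proof
    fix x y assume xy: "x \<in> X" "y \<in> X" "dist x y < \<delta>"
    then obtain W where W: "W \<in> \<G>" "ball x \<delta> \<subseteq> W" using d by meson
    then have "x \<in> X \<inter> W" "y \<in> X \<inter> W" using xy d(1) by auto
    then show "\<exists>C. connected C \<and> C \<subseteq> X \<and> x \<in> C \<and> y \<in> C \<and> (\<forall>z\<in>C. dist x z < \<epsilon>)"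
      using W(1) by (intro exI[of _ "X \<inter> W"]) (auto simp: \<G>_def)
  qed (use d in auto)
qed

text \<open>
  Two points of a connected set are joined in that set by chains of points with steps below \<open>\<eta>\<close>. The
  point here is that the length \<open>N\<close> of the chain depends on \<open>X\<close> and \<open>\<eta>\<close> only. Cover \<open>X\<close> by finitely many
  balls of radius \<open>\<eta>/2\<close>; a chain of balls consecutively meeting inside \<open>C\<close> can be shortened until no link
  repeats. The common length lets the path construction below refine all links of a chain on one
  uniform grid of parameters.
\<close>

lemma connected_chain_bounded_length:
  fixes X :: "'a::metric_space set"
  assumes "compact X" "\<eta> > 0"
  obtains N :: nat where "N > 0"
    "\<And>C x y. connected C \<Longrightarrow> C \<subseteq> X \<Longrightarrow> x \<in> C \<Longrightarrow> y \<in> C \<Longrightarrow>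
       \<exists>c. c 0 = x \<and> c N = y \<and> (\<forall>i. c i \<in> C) \<and> (\<forall>i. dist (c i) (c (Suc i)) < \<eta>)"
proof -
  obtain T where T: "finite T" "X \<subseteq> (\<Union>t\<in>T. ball t (\<eta>/2))"
    using \<open>compact X\<close> \<open>\<eta> > 0\<close> unfolding compact_eq_totally_bounded by (meson half_gt_zero)
  define b where "b t = ball t (\<eta>/2)" for t :: 'a
  have bd: "dist u v < \<eta>" if "u \<in> b t" "v \<in> b t" for u v t
    using that dist_triangle_half_r[of t u \<eta> v] by (auto simp: b_def)
  show ?thesis
  proof
    fix C x y
    assume C: "connected C" "C \<subseteq> X" "x \<in> C" "y \<in> C"
    define R where "R = {(s,t). s \<in> T \<and> t \<in> T \<and> b s \<inter> b t \<inter> C \<noteq> {}}"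
    have RT: "R \<subseteq> T \<times> T" by (auto simp: R_def)
    have finR: "finite R" using finite_subset[OF RT] T(1) by auto
    have cardR: "card R \<le> card T * card T"
      using card_mono[OF _ RT] T(1) by (simp add: card_cartesian_product)
    have cov: "\<exists>t\<in>T. u \<in> b t" if "u \<in> C" for u
      using T(2) C(2) that by (fastforce simp: b_def)
    obtain s where s: "s \<in> T" "x \<in> b s" using cov C(3) by auto
    have "\<forall>t\<in>T. y \<in> b t \<longrightarrow> (s,t) \<in> R\<^sup>*"
    proof (rule connected_induction_simple[OF C(1) C(3) C(4), where P = "\<lambda>z. \<forall>t\<in>T. z \<in> b t \<longrightarrow> (s,t) \<in> R\<^sup>*"])
      show "\<forall>t\<in>T. x \<in> b t \<longrightarrow> (s,t) \<in> R\<^sup>*"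
        using s C(3) by (auto simp: R_def intro!: r_into_rtrancl)
    next
      fix a assume "a \<in> C"
      then obtain t where t: "t \<in> T" "a \<in> b t" using cov by auto
      show "\<exists>U. openin (top_of_set C) U \<and> a \<in> U \<and> (\<forall>u\<in>U. \<forall>v\<in>U. (\<forall>t\<in>T. u \<in> b t \<longrightarrow> (s,t) \<in> R\<^sup>*)
               \<longrightarrow> (\<forall>t\<in>T. v \<in> b t \<longrightarrow> (s,t) \<in> R\<^sup>*))"
      proof (intro exI[of _ "C \<inter> b t"] conjI ballI impI)
        show "openin (top_of_set C) (C \<inter> b t)" by (auto simp: b_def)
        show "a \<in> C \<inter> b t" using t \<open>a \<in> C\<close> by auto
        fix u v t' assume *: "u \<in> C \<inter> b t" "v \<in> C \<inter> b t" "\<forall>t\<in>T. u \<in> b t \<longrightarrow> (s,t) \<in> R\<^sup>*"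
          "t' \<in> T" "v \<in> b t'"
        then have "(s,t) \<in> R\<^sup>*" "(t,t') \<in> R" using t by (auto simp: R_def)
        then show "(s,t') \<in> R\<^sup>*" by simp
      qed
    qed
    then obtain t where t: "t \<in> T" "y \<in> b t" "(s,t) \<in> R\<^sup>*" using cov C(4) by auto
    then obtain n where n: "n \<le> card R" "(s,t) \<in> R ^^ n"
      unfolding rtrancl_finite_eq_relpow[OF finR] by auto
    then obtain f where f: "f 0 = s" "f n = t" "\<And>i. i < n \<Longrightarrow> (f i, f (Suc i)) \<in> R"
      unfolding relpow_fun_conv by auto
    then have "\<forall>i. \<exists>z. i < n \<longrightarrow> z \<in> b (f i) \<inter> b (f (Suc i)) \<inter> C"
      unfolding R_def by blast
    then obtain z where z: "\<And>i. i < n \<Longrightarrow> z i \<in> b (f i) \<inter> b (f (Suc i)) \<inter> C"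
      by metis
    define c where "c i = (if i = 0 then x else if i \<le> n then z (i-1) else y)" for i
    have cb: "c i \<in> b (f i)" if "i \<le> n" for i
      using that s(2) f(1) z[of "i-1"] by (cases i) (auto simp: c_def)
    have cb': "c (Suc i) \<in> b (f i)" if "i \<le> n" for i
      using that t(2) f(2) z[of i] by (cases "i = n") (auto simp: c_def)
    have "dist (c i) (c (Suc i)) < \<eta>" for i
    proof (cases "i \<le> n")
      case True then show ?thesis using bd cb cb' by blast
    next
      case False then show ?thesis using \<open>\<eta> > 0\<close> by (auto simp: c_def)
    qed
    moreover have "c i \<in> C" for i
      using C z[of "i-1"] by (cases i) (auto simp: c_def)
    moreover have "c 0 = x" "c (Suc (card T * card T)) = y"
      using n(1) cardR by (auto simp: c_def)
    ultimately show "\<exists>c. c 0 = x \<and> c (Suc (card T * card T)) = y \<and> (\<forall>i. c i \<in> C) \<and> (\<forall>i. dist (c i) (c (Suc i)) < \<eta>)"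
      by blast
  qed simp
qed

text \<open>
  The cell of the grid with \<open>m\<close> steps that contains \<open>t\<close> can be read off from the cell in the refined
  grid with \<open>m * k\<close> steps.
\<close>

lemma nat_floor_mult_div:
  fixes t :: real and m k :: nat
  assumes "0 \<le> t" "0 < k"
  shows "nat \<lfloor>t * real (m * k)\<rfloor> div k = nat \<lfloor>t * real m\<rfloor>"
proof -
  have "\<lfloor>t * real m\<rfloor> = \<lfloor>t * real (m * k) / real k\<rfloor>"
    using assms by simp
  also have "\<dots> = \<lfloor>t * real (m * k)\<rfloor> div int k"
    by (metis floor_divide_real_eq_div of_int_of_nat_eq of_nat_0_le_iff)
  finally have *: "\<lfloor>t * real m\<rfloor> = \<lfloor>t * real (m * k)\<rfloor> div int k" .
  show ?thesis
    unfolding * by (simp add: nat_div_distrib' assms)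
qed
text \<open>
  The heart of Mazurkiewicz's theorem. A function \<open>f n\<close> on the naturals is a chain whose points are
  indexed by a grid of \<open>M n\<close> equal steps of \<open>[0,1]\<close>. Close consecutive points of it lie in a common
  connected set of diameter about \<open>e n\<close>, and within that set \<open>f (Suc n)\<close> replaces the link by a chain of
  \<open>N n\<close> much smaller links. So \<open>f (Suc n)\<close> stays within \<open>e n\<close> of \<open>f n\<close>, and as \<open>e\<close> is a geometric
  sequence the chains converge uniformly, to a path.
\<close>

lemma locally_connected_imp_short_path:
  fixes X :: "'a::metric_space set"
  assumes "compact X" "locally connected X" "\<epsilon> > 0"
  obtains \<delta> where "\<delta> > 0"
    "\<And>x y. x \<in> X \<Longrightarrow> y \<in> X \<Longrightarrow> dist x y < \<delta> \<Longrightarrow>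
       \<exists>p. path p \<and> path_image p \<subseteq> X \<inter> cball x \<epsilon> \<and> pathstart p = x \<and> pathfinish p = y"
proof -
  define e where "e n = (\<epsilon>/2) / 2^n" for n :: nat
  have e: "e n > 0" "e (Suc n) = e n / 2" for n
    using \<open>\<epsilon> > 0\<close> by (auto simp: e_def)
  have "\<exists>\<delta>>0. \<forall>x\<in>X. \<forall>y\<in>X. dist x y < \<delta> \<longrightarrow>
       (\<exists>C. connected C \<and> C \<subseteq> X \<and> x \<in> C \<and> y \<in> C \<and> (\<forall>z\<in>C. dist x z < e n))" for n
    using uniformly_locally_connected[OF assms(1,2) e(1)[of n]] by metis
  then obtain \<delta> where \<delta>: "\<And>n. \<delta> n > 0"
    "\<And>n x y. x \<in> X \<Longrightarrow> y \<in> X \<Longrightarrow> dist x y < \<delta> n \<Longrightarrow>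
       \<exists>C. connected C \<and> C \<subseteq> X \<and> x \<in> C \<and> y \<in> C \<and> (\<forall>z\<in>C. dist x z < e n)"
    by metis
  have "\<exists>N>0. \<forall>C x y. connected C \<longrightarrow> C \<subseteq> X \<longrightarrow> x \<in> C \<longrightarrow> y \<in> C \<longrightarrow>
       (\<exists>c. c 0 = x \<and> c N = y \<and> (\<forall>i. c i \<in> C) \<and> (\<forall>i. dist (c i) (c (Suc i)) < \<delta> (Suc n)))" for n
    by (rule connected_chain_bounded_length[OF assms(1) \<delta>(1)[of "Suc n"]]) metis
  then obtain N where N: "\<And>n. N n > (0::nat)"
    "\<And>n C x y. connected C \<Longrightarrow> C \<subseteq> X \<Longrightarrow> x \<in> C \<Longrightarrow> y \<in> C \<Longrightarrow>
       \<exists>c. c 0 = x \<and> c (N n) = y \<and> (\<forall>i. c i \<in> C) \<and> (\<forall>i. dist (c i) (c (Suc i)) < \<delta> (Suc n))"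
    by metis
  define good where "good n x y c \<longleftrightarrow> c 0 = x \<and> c (N n) = y \<and>
      (\<forall>i. c i \<in> X \<and> dist x (c i) < e n \<and> dist (c i) (c (Suc i)) < \<delta> (Suc n))" for n x y c
  define c where "c n x y = (SOME c. good n x y c)" for n x y
  have c: "good n x y (c n x y)" if xy: "x \<in> X" "y \<in> X" "dist x y < \<delta> n" for n x y
  proof -
    obtain C where C: "connected C" "C \<subseteq> X" "x \<in> C" "y \<in> C" "\<forall>z\<in>C. dist x z < e n"
      using \<delta>(2)[OF xy] by blast
    have "\<exists>c. good n x y c"
      using N(2)[OF C(1-4), of n] C(2,5) unfolding good_def by blast
    then show ?thesis unfolding c_def by (rule someI_ex)
  qed
  define M where "M n = (\<Prod>k<n. N k)" for n
  have M: "M 0 = 1" "M (Suc n) = M n * N n" "M n > 0" for n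
    using N(1) by (auto simp: M_def intro!: prod_pos)
  show ?thesis
  proof (rule that[OF \<delta>(1)[of 0]])
    fix x y assume xy: "x \<in> X" "y \<in> X" "dist x y < \<delta> 0"
    \<comment> \<open>At level 0 the grid has a single step, from \<open>x\<close> to \<open>y\<close>; all chains are continued by the constant \<open>y\<close>
      so that no bound on the index is needed.\<close>
    define f where "f = rec_nat (\<lambda>i. if i = 0 then x else y)
       (\<lambda>n g i. c n (g (i div N n)) (g (Suc (i div N n))) (i mod N n))"
    have f0: "f 0 i = (if i = 0 then x else y)" for i by (simp add: f_def)
    have fS: "f (Suc n) i = c n (f n (i div N n)) (f n (Suc (i div N n))) (i mod N n)" for n i
      by (simp add: f_def)
    have inv: "(\<forall>i. f n i \<in> X \<and> dist (f n i) (f n (Suc i)) < \<delta> n)" for n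
    proof (induction n)
      case 0 then show ?case using xy \<delta>(1) by (auto simp: f0)
    next
      case (Suc n)
      show ?case
      proof (intro allI conjI)
        fix i
        define q r where "q = i div N n" and "r = i mod N n"
        have cq: "c n (f n q) (f n (Suc q)) 0 = f n q \<and> c n (f n q) (f n (Suc q)) (N n) = f n (Suc q) \<and>
      (\<forall>i. c n (f n q) (f n (Suc q)) i \<in> X \<and> dist (f n q) (c n (f n q) (f n (Suc q)) i) < e n \<and>
         dist (c n (f n q) (f n (Suc q)) i) (c n (f n q) (f n (Suc q)) (Suc i)) < \<delta> (Suc n))" for q
          using c Suc.IH unfolding good_def by blast
        have fi: "f (Suc n) i = c n (f n q) (f n (Suc q)) r"
          by (simp add: fS q_def r_def)
        then show "f (Suc n) i \<in> X" using cq by simp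
        have "f (Suc n) (Suc i) = c n (f n q) (f n (Suc q)) (Suc r)"
        proof (cases "Suc r = N n")
          case True
          then have "Suc i div N n = Suc q" "Suc i mod N n = 0"
            by (auto simp: q_def r_def div_Suc mod_Suc)
          then show ?thesis using cq True by (simp add: fS)
        next
          case False
          then have "Suc i div N n = q" "Suc i mod N n = Suc r"
            by (auto simp: q_def r_def div_Suc mod_Suc)
          then show ?thesis by (simp add: fS)
        qed
        then show "dist (f (Suc n) i) (f (Suc n) (Suc i)) < \<delta> (Suc n)"
          using cq fi by simp
      qed
    qed
    have cf: "c n (f n q) (f n (Suc q)) 0 = f n q \<and> c n (f n q) (f n (Suc q)) (N n) = f n (Suc q) \<and>
      (\<forall>i. c n (f n q) (f n (Suc q)) i \<in> X \<and> dist (f n q) (c n (f n q) (f n (Suc q)) i) < e n \<and>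
         dist (c n (f n q) (f n (Suc q)) i) (c n (f n q) (f n (Suc q)) (Suc i)) < \<delta> (Suc n))" for n q
      using c inv unfolding good_def by blast
    have f_start: "f n 0 = x" for n
      by (induction n) (use cf in \<open>auto simp: f0 fS\<close>)
    have f_end: "f n (M n) = y" for n
      by (induction n) (use cf N(1) in \<open>auto simp: f0 fS M\<close>)
    have f_step: "dist (f n i) (f n (Suc i)) < e n" for n i
      using cf[of n i] by metis
    have f_refine: "dist (f n (i div N n)) (f (Suc n) i) < e n" for n i
      using cf[of n "i div N n"] by (simp add: fS)
    define a where "a t n = f n (nat \<lfloor>t * real (M n)\<rfloor>)" for t n
    have a_step: "dist (a t n) (a t (Suc n)) < e n" if "t \<ge> 0" for t n
      using f_refine[of n "nat \<lfloor>t * real (M (Suc n))\<rfloor>"] that N(1)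
      by (simp add: a_def M(2) nat_floor_mult_div del: of_nat_mult)
    \<comment> \<open>As \<open>e\<close> is halved at each level, the sum of \<open>e n, \<dots>, e (n+k-1)\<close> telescopes.\<close>
    have a_tail: "dist (a t n) (a t (n + k)) \<le> 2 * e n - 2 * e (n + k)" if "t \<ge> 0" for t n k
    proof (induction k)
      case (Suc k)
      have "dist (a t n) (a t (n + Suc k)) \<le> dist (a t n) (a t (n+k)) + dist (a t (n+k)) (a t (Suc (n+k)))"
        by (simp add: dist_triangle)
      then show ?case using Suc a_step[OF that, of "n+k"] e(2)[of "n+k"] by simp
    qed auto
    have e_lim: "e \<longlonglongrightarrow> 0"
      unfolding e_def by real_asymp
    have "\<exists>l\<in>X. a t \<longlonglongrightarrow> l" if t: "t \<ge> 0" for t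
    proof -
      have "Cauchy (a t)"
      proof (rule CauchyI')
        fix r :: real assume "r > 0"
        then obtain m where m: "e m < r/4"
          using order_tendstoD(2)[OF e_lim, of "r/4"] eventually_happens'[of sequentially]
          by (metis divide_pos_pos trivial_limit_sequentially zero_less_numeral)
        have "dist (a t k) (a t j) < r" if "m \<le> k" "k < j" for k j
        proof -
          define k' j' where "k' = k - m" and "j' = j - m"
          have k': "k = m + k'" "j = m + j'" using that by (auto simp: k'_def j'_def)
          have "dist (a t m) (a t k) < r/2" "dist (a t m) (a t j) < r/2"
            using a_tail[OF t, of m k'] a_tail[OF t, of m j'] m e(1)[of k] e(1)[of j] unfolding k' by auto
          then show ?thesis by (rule dist_triangle_half_r)
        qed
        then show "\<exists>M. \<forall>m\<ge>M. \<forall>n>m. dist (a t m) (a t n) < r" by blast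
      qed
      moreover have "a t n \<in> X" for n using inv by (simp add: a_def)
      ultimately show ?thesis
        using compact_imp_complete[OF \<open>compact X\<close>] unfolding complete_def by blast
    qed
    then obtain F where F: "\<And>t. t \<ge> 0 \<Longrightarrow> F t \<in> X" "\<And>t. t \<ge> 0 \<Longrightarrow> a t \<longlonglongrightarrow> F t" by metis
    have Fa: "dist (a t n) (F t) \<le> 2 * e n" if "t \<ge> 0" for t n
    proof (rule tendsto_upperbound)
      show "(\<lambda>k. dist (a t n) (a t (k + n))) \<longlonglongrightarrow> dist (a t n) (F t)"
        by (intro tendsto_intros LIMSEQ_ignore_initial_segment F that)
      have "dist (a t n) (a t (k + n)) \<le> 2 * e n" for k
        using a_tail[OF that, of n k] e(1)[of "n+k"] by (simp add: add.commute)
      then show "eventually (\<lambda>k. dist (a t n) (a t (k + n)) \<le> 2 * e n) sequentially" by simp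
    qed simp
    have near: "dist (F s) (F t) \<le> 5 * e n" if st: "0 \<le> s" "s \<le> t" "t - s < 1 / real (M n)" for s t n
    proof -
      have "t * real (M n) < s * real (M n) + 1"
        using st(3) M(3)[of n] by (simp add: field_simps)
      moreover have "s * real (M n) \<le> t * real (M n)"
        using st(2) by (simp add: mult_right_mono)
      ultimately have "\<lfloor>t * real (M n)\<rfloor> = \<lfloor>s * real (M n)\<rfloor> \<or> \<lfloor>t * real (M n)\<rfloor> = \<lfloor>s * real (M n)\<rfloor> + 1"
        by linarith
      moreover have "\<lfloor>s * real (M n)\<rfloor> \<ge> 0" using st(1) by simp
      ultimately have "nat \<lfloor>t * real (M n)\<rfloor> = nat \<lfloor>s * real (M n)\<rfloor> \<or> nat \<lfloor>t * real (M n)\<rfloor> = Suc (nat \<lfloor>s * real (M n)\<rfloor>)"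
        by linarith
      then have "dist (a s n) (a t n) \<le> e n"
        using f_step[of n] e(1)[of n] by (auto simp: a_def less_imp_le)
      moreover have "dist (F s) (F t) \<le> dist (a s n) (F s) + dist (a s n) (a t n) + dist (a t n) (F t)"
        using dist_triangle[of "F s" "F t" "a s n"] dist_triangle[of "a s n" "F t" "a t n"]
        by (simp add: dist_commute)
      ultimately show ?thesis using Fa[of s n] Fa[of t n] st by linarith
    qed
    have "continuous_on {0..1} F"
      unfolding continuous_on_iff
    proof (intro ballI allI impI)
      fix s r :: real assume s: "s \<in> {0..1}" and "r > 0"
      obtain n where n: "e n < r/5"
        using order_tendstoD(2)[OF e_lim, of "r/5"] \<open>r > 0\<close> eventually_happens'[of sequentially]
        by (metis divide_pos_pos trivial_limit_sequentially zero_less_numeral)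
      have "dist (F t) (F s) < r" if "t \<in> {0..1}" "dist t s < 1 / real (M n)" for t
      proof (cases "s \<le> t")
        case True
        then show ?thesis using near[of s t n] that s n by (auto simp: dist_real_def dist_commute)
      next
        case False
        then show ?thesis using near[of t s n] that s n by (auto simp: dist_real_def)
      qed
      then show "\<exists>d>0. \<forall>t\<in>{0..1}. dist t s < d \<longrightarrow> dist (F t) (F s) < r"
        using M(3)[of n] by (intro exI[of _ "1 / real (M n)"]) auto
    qed
    moreover have "F 0 = x"
    proof -
      have "a 0 = (\<lambda>n. x)" by (simp add: a_def f_start fun_eq_iff)
      then show ?thesis using F(2)[of 0] by (simp add: LIMSEQ_const_iff)
    qed
    moreover have "F 1 = y"
    proof -
      have "a 1 = (\<lambda>n. y)" by (simp add: a_def f_end fun_eq_iff)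
      then show ?thesis using F(2)[of 1] by (simp add: LIMSEQ_const_iff)
    qed
    moreover have "dist x (F t) \<le> \<epsilon>" if "t \<in> {0..1}" for t
    proof (cases "t = 1")
      case True
      have "dist x y < e 0" using f_step[of 0 0] by (simp add: f0)
      then show ?thesis using True \<open>F 1 = y\<close> \<open>\<epsilon> > 0\<close> by (simp add: e_def)
    next
      case False
      then have "\<lfloor>t\<rfloor> = 0" using that by (simp add: floor_unique)
      then have "a t 0 = x" by (simp add: a_def M f_start)
      then show ?thesis using Fa[of t 0] that by (simp add: e_def)
    qed
    ultimately show "\<exists>p. path p \<and> path_image p \<subseteq> X \<inter> cball x \<epsilon> \<and> pathstart p = x \<and> pathfinish p = y"
      using F(1) by (intro exI[of _ F]) (auto simp: path_def path_image_def pathstart_def pathfinish_def)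
  qed
qed

theorem compact_locally_connected_imp_locally_path_connected:
  fixes X :: "'a::metric_space set"
  assumes "compact X" "locally connected X"
  shows "locally path_connected X"
  unfolding locally_path_connected_im_kleinen
proof (intro allI impI)
  fix V x assume V: "openin (top_of_set X) V \<and> x \<in> V"
  then obtain r where r: "r > 0" "X \<inter> ball x r \<subseteq> V"
    unfolding openin_contains_ball by (metis Int_commute)
  then obtain \<delta> where \<delta>: "\<delta> > 0"
    "\<And>x y. x \<in> X \<Longrightarrow> y \<in> X \<Longrightarrow> dist x y < \<delta> \<Longrightarrow>
       \<exists>p. path p \<and> path_image p \<subseteq> X \<inter> cball x (r/2) \<and> pathstart p = x \<and> pathfinish p = y"
    using locally_connected_imp_short_path[OF assms, of "r/2"] by (metis half_gt_zero)
  have x: "x \<in> X" using V openin_imp_subset by blast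
  have sub: "X \<inter> cball x (r/2) \<subseteq> V" using r by (auto simp: subset_iff)
  show "\<exists>u. openin (top_of_set X) u \<and> x \<in> u \<and> u \<subseteq> V \<and>
     (\<forall>y. y \<in> u \<longrightarrow> (\<exists>p. path p \<and> path_image p \<subseteq> V \<and> pathstart p = x \<and> pathfinish p = y))"
  proof (intro exI[of _ "V \<inter> ball x \<delta>"] conjI allI impI)
    show "openin (top_of_set X) (V \<inter> ball x \<delta>)"
      using V by (simp add: openin_Int_open)
    fix y assume "y \<in> V \<inter> ball x \<delta>"
    then have "y \<in> X" "dist x y < \<delta>" using V openin_imp_subset by auto
    then show "\<exists>p. path p \<and> path_image p \<subseteq> V \<and> pathstart p = x \<and> pathfinish p = y"
      using \<delta>(2)[OF x] sub by (meson subset_trans)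
  qed (use V \<delta> in auto)
qed

section \<open>Arcs in spaces without simple closed curves\<close>

text \<open>
  Replace the path by an arc \<open>h\<close>. Going from \<open>z\<close> along \<open>g\<close> in both directions until \<open>h\<close> is reached for
  the first time cuts out a subarc of \<open>g\<close> that touches \<open>h\<close> exactly in its ends. The piece of \<open>h\<close> between
  these ends closes it up.
\<close>

lemma simple_closed_curve_of_arc_and_avoiding_path:
  fixes X :: "'b::{complete_space,real_normed_vector} set"
  assumes g: "arc g" "path_image g \<subseteq> X"
    and z: "z \<in> path_image g"
    and p: "path p" "path_image p \<subseteq> X" "z \<notin> path_image p"
      "pathstart p = pathstart g" "pathfinish p = pathfinish g"
  shows "\<exists>\<gamma>. simple_path \<gamma> \<and> pathfinish \<gamma> = pathstart \<gamma> \<and> path_image \<gamma> \<subseteq> X"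
proof -
  obtain h where h: "arc h" "path_image h \<subseteq> path_image p" "pathstart h = pathstart g" "pathfinish h = pathfinish g"
    using path_contains_arc[OF p(1,4,5)] arc_distinct_ends[OF g(1)] by metis
  let ?H = "path_image h"
  have gc: "continuous_on {0..1} g" and ginj: "inj_on g {0..1}"
    using g(1) by (auto simp: arc_def path_def)
  obtain t0 where t0: "t0 \<in> {0..1}" "g t0 = z" using z by (auto simp: path_image_def)
  have zH: "z \<notin> ?H" using h p by auto
  have "closed ?H" by (simp add: closed_path_image arc_imp_path h)
  then have "closed ({0..1} \<inter> g -` ?H)"
    using continuous_on_closed_vimage[of "{0..1::real}" g] gc by (metis Int_commute closed_atLeastAtMost)
  then have comp: "compact ({0..t0} \<inter> (g -` ?H))" "compact ({t0..1} \<inter> (g -` ?H))"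
  proof -
    assume *: "closed ({0..1} \<inter> g -` ?H)"
    have "{0..t0} \<inter> (g -` ?H) = {0..t0} \<inter> ({0..1} \<inter> g -` ?H)" "{t0..1} \<inter> (g -` ?H) = {t0..1} \<inter> ({0..1} \<inter> g -` ?H)"
      using t0 by auto
    then show "compact ({0..t0} \<inter> (g -` ?H))" "compact ({t0..1} \<inter> (g -` ?H))"
      using * by (metis compact_Int_closed compact_Icc)+
  qed
  have "g 0 \<in> ?H" "g 1 \<in> ?H"
    using h pathstart_in_path_image[of h] pathfinish_in_path_image[of h] by (auto simp: pathstart_def pathfinish_def)
  then have ne: "{0..t0} \<inter> (g -` ?H) \<noteq> {}" "{t0..1} \<inter> (g -` ?H) \<noteq> {}"
    using t0 by auto
  \<comment> \<open>The last time before and the first time after \<open>t0\<close> at which \<open>g\<close> is on \<open>h\<close>.\<close>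
  obtain u where u: "u \<in> {0..t0}" "g u \<in> ?H" "\<And>s. s \<in> {0..t0} \<Longrightarrow> g s \<in> ?H \<Longrightarrow> s \<le> u"
    using compact_attains_sup[OF comp(1) ne(1)] by auto
  obtain v where v: "v \<in> {t0..1}" "g v \<in> ?H" "\<And>s. s \<in> {t0..1} \<Longrightarrow> g s \<in> ?H \<Longrightarrow> v \<le> s"
    using compact_attains_inf[OF comp(2) ne(2)] by auto
  have "u \<noteq> t0" "v \<noteq> t0"
    using u(2) v(2) t0(2) zH by auto
  then have uv: "u \<noteq> t0" "v \<noteq> t0" "u < v" "u \<in> {0..1}" "v \<in> {0..1}"
    using u(1) v(1) t0(1) by auto
  have guv: "g u \<noteq> g v" using inj_onD[OF ginj _ uv(4,5)] uv(3) by auto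
  obtain a where a: "a \<in> {0..1}" "h a = g u" using u(2) by (auto simp: path_image_def)
  obtain b where b: "b \<in> {0..1}" "h b = g v" using v(2) by (auto simp: path_image_def)
  have ab: "a \<noteq> b" using a b guv by auto
  define \<alpha> where "\<alpha> = subpath u v g"
  define \<beta> where "\<beta> = subpath b a h"
  have arcs: "arc \<alpha>" "arc \<beta>"
    unfolding \<alpha>_def \<beta>_def using g(1) h(1) uv a b ab by (auto intro!: arc_subpath_arc)
  have im: "path_image \<alpha> = g ` {u..v}" "path_image \<beta> \<subseteq> ?H"
    using uv path_image_subpath_subset[OF b(1) a(1), of h] by (auto simp: \<alpha>_def \<beta>_def path_image_subpath)
  have "path_image \<alpha> \<inter> path_image \<beta> \<subseteq> {g u, g v}"
  proof
    fix w assume w: "w \<in> path_image \<alpha> \<inter> path_image \<beta>"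
    then obtain s where s: "s \<in> {u..v}" "w = g s" "g s \<in> ?H" using im by auto
    show "w \<in> {g u, g v}"
      using u(3)[of s] v(3)[of s] s uv by (cases "s \<le> t0") force+
  qed
  then have "simple_path (\<alpha> +++ \<beta>)"
    using arcs a b by (intro simple_path_join_loop) (auto simp: \<alpha>_def \<beta>_def)
  moreover have "path_image (\<alpha> +++ \<beta>) \<subseteq> X"
  proof -
    have "path_image \<alpha> \<subseteq> path_image g"
      using im(1) uv by (auto simp: path_image_def)
    then show ?thesis
      using path_image_join_subset[of \<alpha> \<beta>] im(2) h(2) p(2) g(2) by blast
  qed
  moreover have "pathfinish (\<alpha> +++ \<beta>) = pathstart (\<alpha> +++ \<beta>)"
    using a by (simp add: \<alpha>_def \<beta>_def)
  ultimately show ?thesis by blast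
qed

text \<open>
  If the arc left \<open>A\<close> at \<open>z\<close>, then \<open>A\<close> would lie in a single component of \<open>X - {z}\<close>, which is path
  connected; a path in it between the ends of the arc would create a simple closed curve.
\<close>

lemma arc_image_subset_subcontinuum:
  fixes X :: "'b::{complete_space,real_normed_vector} set"
  assumes X: "compact X" "locally connected X"
    and no_loop: "\<not> (\<exists>\<gamma>. simple_path \<gamma> \<and> pathfinish \<gamma> = pathstart \<gamma> \<and> path_image \<gamma> \<subseteq> X)"
    and A: "closed A" "connected A" "A \<subseteq> X"
    and g: "arc g" "path_image g \<subseteq> X" "pathstart g \<in> A" "pathfinish g \<in> A"
  shows "path_image g \<subseteq> A"
proof
  fix z assume z: "z \<in> path_image g"
  show "z \<in> A"
  proof (rule ccontr)
    assume zA: "z \<notin> A"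
    have lpc: "locally path_connected X"
      by (rule compact_locally_connected_imp_locally_path_connected[OF X])
    let ?W = "X - {z}"
    have W: "openin (top_of_set X) ?W"
      by (simp add: Diff_eq openin_open_Int open_Compl)
    have "locally path_connected ?W"
      using locally_open_subset[OF lpc W] .
    moreover have "connected_component ?W (pathstart g) (pathfinish g)"
      using A g zA unfolding connected_component_def by (intro exI[of _ A]) auto
    ultimately have "path_component ?W (pathstart g) (pathfinish g)"
      by (simp add: path_component_eq_connected_component)
    then obtain p where p: "path p" "path_image p \<subseteq> ?W" "pathstart p = pathstart g" "pathfinish p = pathfinish g"
      unfolding path_component_def by auto
    show False
      using simple_closed_curve_of_arc_and_avoiding_path[OF g(1,2) z p(1) _ _ p(3,4)] p(2) no_loop by auto
  qed
qed

text \<open>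
  Any two points of \<open>A \<inter> B\<close> are the ends of an arc in \<open>X\<close>, and both \<open>A\<close> and \<open>B\<close> contain it.
\<close>

lemma connected_Int_of_subcontinua_Banach:
  fixes X :: "'b::{complete_space,real_normed_vector} set"
  assumes X: "compact X" "locally connected X" "connected X"
    and no_loop: "\<not> (\<exists>\<gamma>. simple_path \<gamma> \<and> pathfinish \<gamma> = pathstart \<gamma> \<and> path_image \<gamma> \<subseteq> X)"
    and A: "closed A" "connected A" "A \<subseteq> X"
    and B: "closed B" "connected B" "B \<subseteq> X"
  shows "connected (A \<inter> B)"
proof -
  have "path_connected X"
    using X compact_locally_connected_imp_locally_path_connected[OF X(1,2)]
    by (metis connected_component_eq_self path_component_eq_connected_component_set
        path_connected_component_set)
  have "path_component (A \<inter> B) x y" if xy: "x \<in> A \<inter> B" "y \<in> A \<inter> B" for x y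
  proof (cases "x = y")
    case True then show ?thesis using that by (simp add: path_component_refl)
  next
    case False
    obtain p where p: "path p" "path_image p \<subseteq> X" "pathstart p = x" "pathfinish p = y"
      using \<open>path_connected X\<close>[unfolded path_connected_def, rule_format, of x y] xy A(3) by blast
    then obtain g where g: "arc g" "path_image g \<subseteq> path_image p" "pathstart g = x" "pathfinish g = y"
      using path_contains_arc False by metis
    then have "path_image g \<subseteq> A" "path_image g \<subseteq> B"
      using arc_image_subset_subcontinuum[OF X(1,2) no_loop A g(1)] arc_image_subset_subcontinuum[OF X(1,2) no_loop B g(1)]
        p that by auto
    then show ?thesis unfolding path_component_def using g arc_imp_path by (intro exI[of _ g]) auto
  qed
  then show ?thesis
    by (simp add: path_connected_component path_connected_imp_connected)
qed

section \<open>Intersections of subcontinua of a dendrite\<close>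

text \<open>
  The isometric embedding of a metric space in a Banach space of bounded functions. The summand
  \<open>dist a y\<close> makes the functions bounded when the metric is not.
\<close>

definition kuratowski :: "'a::metric_space \<Rightarrow> 'a \<Rightarrow> 'a \<Rightarrow>\<^sub>C real" where
  "kuratowski a x = Bcontfun (\<lambda>y. dist x y - dist a y)"

lemma kuratowski_apply: "apply_bcontfun (kuratowski a x) y = dist x y - dist a y"
proof -
  have "(\<lambda>y. dist x y - dist a y) \<in> bcontfun"
  proof (rule bcontfun_normI[where b = "dist x a"])
    show "continuous_on UNIV (\<lambda>y. dist x y - dist a y)"
      by (intro continuous_intros)
    show "norm (dist x y - dist a y) \<le> dist x a" for y
      using abs_dist_diff_le[of x y a] by (simp add: dist_commute)
  qed
  then show ?thesis by (simp add: kuratowski_def Bcontfun_inverse)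
qed

lemma dist_kuratowski: "dist (kuratowski a x) (kuratowski a y) = dist x y"
proof (rule antisym)
  show "dist (kuratowski a x) (kuratowski a y) \<le> dist x y"
    by (rule dist_bound) (use abs_dist_diff_le[of x _ y] in \<open>simp add: kuratowski_apply dist_real_def dist_commute\<close>)
  show "dist x y \<le> dist (kuratowski a x) (kuratowski a y)"
    using dist_bounded[of "kuratowski a x" y "kuratowski a y"] by (simp add: kuratowski_apply dist_real_def)
qed

text \<open>
  The Kuratowski embedding makes the results on arcs in Banach spaces available for an arbitrary metric
  space; being an isometry, it transports all notions involved in both directions.
\<close>

theorem dendrite_connected_Int:
  fixes X :: "'a::metric_space set"
  assumes "dendrite X"
    and A: "closed A" "connected A" "A \<subseteq> X"
    and B: "closed B" "connected B" "B \<subseteq> X"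
  shows "connected (A \<inter> B)"
proof -
  obtain a where "a \<in> X" using assms by (auto simp: dendrite_def continuum_def)
  define f where "f = kuratowski a"
  have df: "dist (f x) (f y) = dist x y" for x y by (simp add: f_def dist_kuratowski)
  have inj: "inj f" by (rule injI) (metis df dist_eq_0_iff)
  define k where "k = inv_into UNIV f"
  have kf: "k (f x) = x" for x using inj by (simp add: k_def)
  have cf: "continuous_on S f" for S
    unfolding continuous_on_iff by (auto simp: df)
  have ck: "continuous_on (f ` S) k" for S
    unfolding continuous_on_iff by (auto simp: df kf)
  have hom: "homeomorphism S (f ` S) f k" for S
    unfolding homeomorphism_def using cf ck by (auto simp: kf image_iff)
  have X: "compact X" "connected X" "locally connected X"
    and nl: "\<not> (\<exists>\<gamma>. simple_path \<gamma> \<and> pathfinish \<gamma> = pathstart \<gamma> \<and> path_image \<gamma> \<subseteq> X)"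
    using assms by (auto simp: dendrite_def continuum_def)
  have "compact (f ` X)" "connected (f ` X)"
    using X cf by (auto intro: compact_continuous_image connected_continuous_image)
  moreover have "locally connected (f ` X)"
    using X(3) homeomorphic_locally[of X "f ` X" connected connected] hom homeomorphic_connectedness
    by (metis homeomorphic_def)
  moreover have "\<not> (\<exists>\<gamma>. simple_path \<gamma> \<and> pathfinish \<gamma> = pathstart \<gamma> \<and> path_image \<gamma> \<subseteq> f ` X)"
  proof
    assume "\<exists>\<gamma>. simple_path \<gamma> \<and> pathfinish \<gamma> = pathstart \<gamma> \<and> path_image \<gamma> \<subseteq> f ` X"
    then obtain \<gamma> where \<gamma>: "simple_path \<gamma>" "pathfinish \<gamma> = pathstart \<gamma>" "path_image \<gamma> \<subseteq> f ` X" by auto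
    have "path (k \<circ> \<gamma>)"
      using \<gamma> ck by (intro path_continuous_image simple_path_imp_path) (auto intro: continuous_on_subset)
    moreover have "loop_free (k \<circ> \<gamma>)"
    proof -
      have "\<gamma> s = \<gamma> t" if "s \<in> {0..1}" "t \<in> {0..1}" "k (\<gamma> s) = k (\<gamma> t)" for s t
      proof -
        have "\<gamma> s \<in> f ` X" "\<gamma> t \<in> f ` X" using that \<gamma>(3) by (auto simp: path_image_def)
        then show ?thesis using that(3) kf by auto
      qed
      then show ?thesis using \<gamma>(1) unfolding simple_path_def loop_free_def by (metis comp_apply)
    qed
    moreover have "path_image (k \<circ> \<gamma>) \<subseteq> X"
      using \<gamma>(3) kf by (auto simp: path_image_def image_subset_iff)
    ultimately show False
      using nl \<gamma>(2) by (metis pathfinish_compose pathstart_compose simple_path_def)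
  qed
  moreover have "closed (f ` S)" "connected (f ` S)" "f ` S \<subseteq> f ` X"
    if "closed S" "connected S" "S \<subseteq> X" for S
  proof -
    have "compact S" using that X(1) by (metis compact_Int_closed inf.absorb_iff2)
    then show "closed (f ` S)" using cf by (intro compact_imp_closed compact_continuous_image)
  qed (use that cf in \<open>auto intro: connected_continuous_image\<close>)
  ultimately have "connected (f ` A \<inter> f ` B)"
    using A B by (intro connected_Int_of_subcontinua_Banach[of "f ` X"]) auto
  also have "f ` A \<inter> f ` B = f ` (A \<inter> B)" using inj by (simp add: image_Int)
  finally have "connected (k ` f ` (A \<inter> B))"
    using connected_continuous_image[OF ck] by blast
  then show ?thesis by (simp add: image_image kf)
qed

section \<open>Subcontinua in unicoherent continua\<close>

text \<open>
  These properties of dendrites are all that the rest of the argument uses; paths and arcs do not occur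
  from here on.
\<close>

locale tree_continuum =
  fixes X :: "'a::metric_space set"
  assumes compact_X: "compact X" and connected_X: "connected X" and X_nonempty: "X \<noteq> {}"
    and loc_conn_X: "locally connected X"
    and unicoherent: "\<And>A B. \<lbrakk>closed A; connected A; A \<subseteq> X; closed B; connected B; B \<subseteq> X\<rbrakk>
      \<Longrightarrow> connected (A \<inter> B)"
begin

text \<open>
  The empty set counts as a subcontinuum, so that intersections of subcontinua are always subcontinua.
\<close>

definition subcontinuum :: "'a set \<Rightarrow> bool" where
  "subcontinuum A \<longleftrightarrow> closed A \<and> connected A \<and> A \<subseteq> X"

lemma subcontinuum_X: "subcontinuum X"
  by (simp add: subcontinuum_def compact_X connected_X compact_imp_closed)

lemma subcontinuum_singleton: "x \<in> X \<Longrightarrow> subcontinuum {x}"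
  by (simp add: subcontinuum_def)

lemma subcontinuum_Int: "subcontinuum A \<Longrightarrow> subcontinuum B \<Longrightarrow> subcontinuum (A \<inter> B)"
  using unicoherent by (auto simp: subcontinuum_def)

lemma subcontinuum_Un: "subcontinuum A \<Longrightarrow> subcontinuum B \<Longrightarrow> A \<inter> B \<noteq> {} \<Longrightarrow> subcontinuum (A \<union> B)"
  by (auto simp: subcontinuum_def intro: connected_Un)

text \<open>
  If \<open>A \<inter> B \<inter> C\<close> were empty, then \<open>A\<close> and \<open>B\<close> would split the connected set \<open>(A \<union> B) \<inter> C\<close> into two
  disjoint closed parts.
\<close>

lemma helly_three:
  assumes A: "subcontinuum A" and B: "subcontinuum B" and C: "subcontinuum C"
    and meet: "A \<inter> B \<noteq> {}" "A \<inter> C \<noteq> {}" "B \<inter> C \<noteq> {}"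
  shows "A \<inter> B \<inter> C \<noteq> {}"
proof
  assume "A \<inter> B \<inter> C = {}"
  moreover have "connected ((A \<union> B) \<inter> C)"
    using subcontinuum_Int[OF subcontinuum_Un[OF A B meet(1)] C] by (simp add: subcontinuum_def)
  ultimately show False
    using connected_closedD[of "(A \<union> B) \<inter> C" A B] meet A B by (auto simp: subcontinuum_def)
qed

lemma helly_finite:
  assumes "finite F" "subcontinuum D" "D \<noteq> {}"
    and "\<And>A. A \<in> F \<Longrightarrow> subcontinuum A" "\<And>A. A \<in> F \<Longrightarrow> D \<inter> A \<noteq> {}"
    and "\<And>A B. A \<in> F \<Longrightarrow> B \<in> F \<Longrightarrow> A \<inter> B \<noteq> {}"
  shows "D \<inter> \<Inter>F \<noteq> {}"
  using assms
proof (induction F arbitrary: D rule: finite_induct)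
  case (insert A F)
  have "(D \<inter> A) \<inter> \<Inter>F \<noteq> {}"
  proof (rule insert.IH)
    show "subcontinuum (D \<inter> A)" using insert.prems by (simp add: subcontinuum_Int)
    show "D \<inter> A \<noteq> {}" using insert.prems by simp
    show "D \<inter> A \<inter> B \<noteq> {}" if "B \<in> F" for B
      using insert.prems that by (intro helly_three) auto
  qed (use insert.prems in auto)
  then show ?case by (simp add: Int_assoc)
qed auto

text \<open>
  Helly's theorem for trees: finite families follow from triples by induction, because a member may be
  replaced by its intersection with another one, and compactness does the rest.
\<close>

theorem helly:
  assumes F: "\<And>A. A \<in> F \<Longrightarrow> subcontinuum A"
    and meet: "\<And>A B. A \<in> F \<Longrightarrow> B \<in> F \<Longrightarrow> A \<inter> B \<noteq> {}"
  shows "X \<inter> \<Inter>F \<noteq> {}"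
proof (rule compact_imp_fip[OF compact_X])
  fix F' assume F': "finite F'" "F' \<subseteq> F"
  have "X \<inter> A \<noteq> {}" if "A \<in> F" for A
    using F[OF that] meet[OF that that] by (auto simp: subcontinuum_def)
  then show "X \<inter> \<Inter>F' \<noteq> {}"
    by (intro helly_finite F'(1) subcontinuum_X X_nonempty) (use F meet subsetD[OF F'(2)] in metis)+
qed (use F in \<open>auto simp: subcontinuum_def\<close>)

lemma subcontinuum_Inter_finite:
  assumes "finite F" "\<And>A. A \<in> F \<Longrightarrow> subcontinuum A"
  shows "subcontinuum (X \<inter> \<Inter>F)"
  using assms
proof (induction F rule: finite_induct)
  case (insert A F)
  then have "subcontinuum (A \<inter> (X \<inter> \<Inter>F))" by (simp add: subcontinuum_Int)
  then show ?case by (simp add: Int_left_commute)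
qed (simp add: subcontinuum_X)

theorem subcontinuum_Inter:
  assumes F: "\<And>A. A \<in> F \<Longrightarrow> subcontinuum A"
  shows "subcontinuum (X \<inter> \<Inter>F)"
proof -
  have cl: "closed (X \<inter> \<Inter>F)"
    using F subcontinuum_X by (auto simp: subcontinuum_def)
  moreover have "connected (X \<inter> \<Inter>F)"
    unfolding connected_closed_set[OF cl]
  proof
    assume "\<exists>A B. closed A \<and> closed B \<and> A \<noteq> {} \<and> B \<noteq> {} \<and> A \<union> B = X \<inter> \<Inter>F \<and> A \<inter> B = {}"
    then obtain P Q where PQ: "closed P" "closed Q" "P \<noteq> {}" "Q \<noteq> {}" "P \<union> Q = X \<inter> \<Inter>F" "P \<inter> Q = {}"
      by auto
    then obtain U V where UV: "open U" "open V" "P \<subseteq> U" "Q \<subseteq> V" "U \<inter> V = {}"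
      using t4_space by metis
    \<comment> \<open>By compactness finitely many members already have their intersection inside \<open>U \<union> V\<close>.\<close>
    have "\<exists>F'. finite F' \<and> F' \<subseteq> F \<and> (X - (U \<union> V)) \<inter> \<Inter>F' = {}"
    proof (rule ccontr)
      assume neg: "\<nexists>F'. finite F' \<and> F' \<subseteq> F \<and> (X - (U \<union> V)) \<inter> \<Inter>F' = {}"
      have "(X - (U \<union> V)) \<inter> \<Inter>F \<noteq> {}"
      proof (rule compact_imp_fip)
        show "compact (X - (U \<union> V))"
          using UV compact_X by (simp add: compact_diff open_Un)
        show "closed T" if "T \<in> F" for T using F[OF that] by (simp add: subcontinuum_def)
        show "(X - (U \<union> V)) \<inter> \<Inter>F' \<noteq> {}" if "finite F'" "F' \<subseteq> F" for F'
          using neg that by blast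
      qed
      moreover have "X \<inter> \<Inter>F \<subseteq> U \<union> V" using PQ(5) UV(3,4) by blast
      ultimately show False by blast
    qed
    then obtain F' where F': "finite F'" "F' \<subseteq> F" "(X - (U \<union> V)) \<inter> \<Inter>F' = {}" by auto
    then have con: "connected (X \<inter> \<Inter>F')"
      using subcontinuum_Inter_finite[of F'] F by (auto simp: subcontinuum_def)
    have sub: "X \<inter> \<Inter>F \<subseteq> X \<inter> \<Inter>F'" using F'(2) by auto
    define K where "K = X \<inter> \<Inter>F'"
    have "P \<union> Q \<subseteq> K"
      unfolding PQ(5) K_def by (rule sub)
    then have "U \<inter> K \<noteq> {}" "V \<inter> K \<noteq> {}"
      using PQ(3,4) UV(3,4) by blast+
    moreover have "K \<subseteq> U \<union> V" using F'(3) unfolding K_def by auto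
    ultimately show False
      using connectedD[OF con[folded K_def] UV(1,2)] UV(5) by auto
  qed
  ultimately show ?thesis by (simp add: subcontinuum_def)
qed

lemma small_subcontinuum_nhd:
  assumes "x \<in> X" "r > 0"
  obtains N U where "subcontinuum N" "N \<subseteq> ball x r" "openin (top_of_set X) U" "x \<in> U" "U \<subseteq> N"
proof -
  have "openin (top_of_set X) (X \<inter> ball x (r/2))" "x \<in> X \<inter> ball x (r/2)"
    using assms by auto
  then obtain U where U: "openin (top_of_set X) U" "connected U" "x \<in> U" "U \<subseteq> X \<inter> ball x (r/2)"
    using loc_conn_X unfolding locally_connected by meson
  have "closure U \<subseteq> X"
    using U(4) compact_X by (meson closure_minimal compact_imp_closed le_inf_iff)
  moreover have "closure U \<subseteq> cball x (r/2)"
    using U(4) by (meson ball_subset_cball closed_cball closure_minimal le_inf_iff order_trans)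
  moreover have "cball x (r/2) \<subseteq> ball x r" using assms by auto
  ultimately show ?thesis
    using U that[of "closure U" U] closure_subset[of U]
    by (simp add: subcontinuum_def connected_imp_connected_closure)
qed

text \<open>
  Connected open sets are joined from the inside by closed pieces. This is the substitute for path
  connectedness.
\<close>

lemma subcontinuum_joining_points:
  assumes W: "openin (top_of_set X) W" "connected W" and xy: "x \<in> W" "y \<in> W"
  obtains C where "subcontinuum C" "C \<subseteq> W" "x \<in> C" "y \<in> C"
proof -
  have "\<exists>C. subcontinuum C \<and> C \<subseteq> W \<and> x \<in> C \<and> y \<in> C"
  proof (rule connected_equivalence_relation[OF W(2) xy, where R = "\<lambda>x y. \<exists>C. subcontinuum C \<and> C \<subseteq> W \<and> x \<in> C \<and> y \<in> C"])
    fix u v w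
    assume "\<exists>C. subcontinuum C \<and> C \<subseteq> W \<and> u \<in> C \<and> v \<in> C" "\<exists>C. subcontinuum C \<and> C \<subseteq> W \<and> v \<in> C \<and> w \<in> C"
    then obtain C D where "subcontinuum C" "C \<subseteq> W" "u \<in> C" "v \<in> C" "subcontinuum D" "D \<subseteq> W" "v \<in> D" "w \<in> D"
      by auto
    then show "\<exists>C. subcontinuum C \<and> C \<subseteq> W \<and> u \<in> C \<and> w \<in> C"
      using subcontinuum_Un[of C D] by (intro exI[of _ "C \<union> D"]) auto
  next
    fix a assume a: "a \<in> W"
    obtain r where r: "r > 0" "ball a r \<inter> X \<subseteq> W"
      using W(1) a unfolding openin_contains_ball by auto
    have "a \<in> X" using a W(1) openin_imp_subset by auto
    then obtain N U where N: "subcontinuum N" "N \<subseteq> ball a r" "openin (top_of_set X) U" "a \<in> U" "U \<subseteq> N"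
      using small_subcontinuum_nhd r(1) by metis
    then have NW: "N \<subseteq> W" using r by (auto simp: subcontinuum_def)
    have "openin (top_of_set W) U"
      using openin_subset_trans[OF N(3), of W] N(5) NW openin_imp_subset[OF W(1)] by blast
    then show "\<exists>T. openin (top_of_set W) T \<and> a \<in> T \<and> (\<forall>x\<in>T. \<exists>C. subcontinuum C \<and> C \<subseteq> W \<and> a \<in> C \<and> x \<in> C)"
      using N NW by (intro exI[of _ U]) blast
  qed auto
  then show ?thesis using that by auto
qed

lemma openin_component:
  assumes "closed Y" "U \<in> components (X - Y)"
  shows "openin (top_of_set X) U"
proof -
  have "openin (top_of_set X) (X - Y)"
    using assms by (simp add: Diff_eq openin_open_Int open_Compl)
  then show ?thesis
    using loc_conn_X assms(2) unfolding locally_connected_open_component by blast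
qed

lemma closure_subset_X: "A \<subseteq> X \<Longrightarrow> closure A \<subseteq> X"
  using compact_X by (simp add: closure_minimal compact_imp_closed)

text \<open>
  A limit point of \<open>U\<close> outside \<open>Y\<close> could be added to \<open>U\<close> without losing connectedness.
\<close>

lemma closure_component_subset:
  assumes "U \<in> components (X - Y)"
  shows "closure U \<subseteq> U \<union> Y"
proof
  fix x assume x: "x \<in> closure U"
  have U: "connected U" "U \<subseteq> X - Y" using assms by (auto simp: in_components_connected in_components_subset)
  have "x \<in> X" using closure_subset_X[of U] U x by auto
  show "x \<in> U \<union> Y"
  proof (rule ccontr)
    assume nx: "x \<notin> U \<union> Y"
    have "connected (insert x U)"
    proof (rule connected_intermediate_closure[OF U(1)])
      show "insert x U \<subseteq> closure U" using x closure_subset[of U] by simp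
    qed auto
    then have "insert x U \<subseteq> U"
      using components_maximal[OF assms, of "insert x U"] U nx \<open>x \<in> X\<close> in_components_nonempty[OF assms] by auto
    then show False using nx by auto
  qed
qed

text \<open>
  Disjoint subcontinua \<open>C\<close> and \<open>D\<close> both joining \<open>N\<close> to \<open>M\<close> would form a cycle. It shows up as a
  disconnected intersection of \<open>C \<union> N\<close> and \<open>D \<union> M\<close>, which has one part in \<open>N\<close> and one in \<open>M\<close>.
\<close>

lemma disjoint_connectors_impossible:
  assumes "subcontinuum N" "subcontinuum M" "N \<inter> M = {}"
    and "subcontinuum C" "subcontinuum D" "C \<inter> D = {}"
    and "C \<inter> N \<noteq> {}" "C \<inter> M \<noteq> {}" "D \<inter> N \<noteq> {}" "D \<inter> M \<noteq> {}"
  shows False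
proof -
  have "subcontinuum (C \<union> N)" "subcontinuum (D \<union> M)"
    using assms by (auto intro: subcontinuum_Un)
  then have "connected ((C \<union> N) \<inter> (D \<union> M))"
    using subcontinuum_Int subcontinuum_def by blast
  moreover have "(C \<union> N) \<inter> (D \<union> M) \<subseteq> M \<union> N" "M \<inter> N \<inter> ((C \<union> N) \<inter> (D \<union> M)) = {}"
    using assms by auto
  ultimately have "M \<inter> ((C \<union> N) \<inter> (D \<union> M)) = {} \<or> N \<inter> ((C \<union> N) \<inter> (D \<union> M)) = {}"
    using assms by (intro connected_closedD) (auto simp: subcontinuum_def)
  then show False using assms by blast
qed

text \<open>
  The subcontinua play the role of small closed balls, which need not be connected.
\<close>

lemma disjoint_small_nhds:
  assumes "x \<in> X" "y \<in> X" "x \<noteq> y"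
  obtains N M U V where "subcontinuum N" "subcontinuum M" "N \<inter> M = {}" "x \<in> U" "U \<subseteq> N" "y \<in> V" "V \<subseteq> M"
    "openin (top_of_set X) U" "openin (top_of_set X) V"
proof -
  define r where "r = dist x y / 2"
  have r: "r > 0" using assms by (simp add: r_def)
  obtain N U where N: "subcontinuum N" "N \<subseteq> ball x r" "openin (top_of_set X) U" "x \<in> U" "U \<subseteq> N"
    using small_subcontinuum_nhd[OF assms(1) r] by metis
  obtain M V where M: "subcontinuum M" "M \<subseteq> ball y r" "openin (top_of_set X) V" "y \<in> V" "V \<subseteq> M"
    using small_subcontinuum_nhd[OF assms(2) r] by metis
  have "ball x r \<inter> ball y r = {}"
    by (rule disjoint_ballI) (simp add: r_def)
  then have "N \<inter> M = {}" using N M by auto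
  then show ?thesis using that N M by metis
qed

text \<open>
  The closure of \<open>U\<close> meets \<open>Y\<close> because \<open>X\<close> is connected. If it met \<open>Y\<close> in two points, a subcontinuum
  inside \<open>U\<close> would join neighbourhoods of these points, and \<open>Y\<close> itself would join them a second time.
\<close>

theorem component_attached_at_one_point:
  assumes Y: "subcontinuum Y" "Y \<noteq> {}" and U: "U \<in> components (X - Y)"
  shows "\<exists>y. closure U \<inter> Y = {y}"
proof -
  have Uo: "openin (top_of_set X) U"
    using openin_component[OF _ U] Y by (simp add: subcontinuum_def)
  have UX: "U \<subseteq> X - Y" "U \<noteq> {}" "connected U"
    using U by (auto simp: in_components_subset in_components_nonempty in_components_connected)
  have "closure U \<inter> Y \<noteq> {}"
  proof
    assume "closure U \<inter> Y = {}"
    then have "closure U = U"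
      using closure_component_subset[OF U] closure_subset[of U] by blast
    then have "closedin (top_of_set X) U"
      using UX by (metis closed_closure closed_subset Diff_subset subset_trans)
    then have "U = X" using connected_X Uo UX(2) unfolding connected_clopen by blast
    then show False using UX Y by (auto simp: subcontinuum_def)
  qed
  moreover have "y = y'" if y: "y \<in> closure U \<inter> Y" "y' \<in> closure U \<inter> Y" for y y'
  proof (rule ccontr)
    assume "y \<noteq> y'"
    moreover have "y \<in> X" "y' \<in> X" using y Y by (auto simp: subcontinuum_def)
    ultimately obtain N M V V' where N: "subcontinuum N" "subcontinuum M" "N \<inter> M = {}" "y \<in> V" "V \<subseteq> N" "y' \<in> V'" "V' \<subseteq> M"
      "openin (top_of_set X) V" "openin (top_of_set X) V'"
      using disjoint_small_nhds by metis
    have meet: "\<exists>u. u \<in> U \<inter> W" if W: "openin (top_of_set X) W" "w \<in> W" "w \<in> closure U" for w W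
    proof -
      obtain O' where "open O'" "W = X \<inter> O'" using W(1) by (auto simp: openin_open)
      then have "O' \<inter> U \<noteq> {}"
        using W open_Int_closure_eq_empty by blast
      then show ?thesis using UX \<open>W = X \<inter> O'\<close> by auto
    qed
    obtain u u' where u: "u \<in> U \<inter> V" "u' \<in> U \<inter> V'"
      using meet[OF N(8) N(4)] meet[OF N(9) N(6)] y by auto
    obtain C where C: "subcontinuum C" "C \<subseteq> U" "u \<in> C" "u' \<in> C"
      using subcontinuum_joining_points[OF Uo UX(3)] u by blast
    show False
      by (rule disjoint_connectors_impossible[OF N(1,2,3) C(1) Y(1)]) (use C u UX N y in auto)
  qed
  ultimately show ?thesis by blast
qed

text \<open>
  Otherwise infinitely many of the sets contain pairs of points at distance at least \<open>\<epsilon>\<close>. Along a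
  subsequence the pairs converge to two distinct points, and two disjoint sets then join
  neighbourhoods of the same two points.
\<close>

theorem disjoint_connected_sets_null:
  assumes B: "\<And>n::nat. openin (top_of_set X) (B n)" "\<And>n. connected (B n)" "\<And>m n. m \<noteq> n \<Longrightarrow> B m \<inter> B n = {}"
    and "\<epsilon> > 0"
  shows "\<exists>n. \<forall>x\<in>B n. \<forall>y\<in>B n. dist x y < \<epsilon>"
proof (rule ccontr)
  assume "\<not> ?thesis"
  then have "\<forall>n. \<exists>x y. x \<in> B n \<and> y \<in> B n \<and> dist x y \<ge> \<epsilon>" by (simp add: not_less Bex_def)
  then obtain x y where xy: "\<And>n. x n \<in> B n" "\<And>n. y n \<in> B n" "\<And>n. dist (x n) (y n) \<ge> \<epsilon>" by metis
  have BX: "B n \<subseteq> X" for n using B(1) openin_imp_subset by blast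
  have "\<forall>n. (x n, y n) \<in> X \<times> X" using xy BX by blast
  moreover have "seq_compact (X \<times> X)"
    using compact_X compact_Times compact_eq_seq_compact_metric by blast
  ultimately obtain l r where l: "l \<in> X \<times> X" "strict_mono r" "((\<lambda>n. (x n, y n)) \<circ> r) \<longlonglongrightarrow> l"
    unfolding seq_compact_def by meson
  obtain a b where ab: "l = (a,b)" by (cases l)
  have lim: "(\<lambda>n. x (r n)) \<longlonglongrightarrow> a" "(\<lambda>n. y (r n)) \<longlonglongrightarrow> b"
    using tendsto_fst[OF l(3)] tendsto_snd[OF l(3)] by (simp_all add: ab comp_def)
  have "dist a b \<ge> \<epsilon>"
    using tendsto_dist[OF lim] by (rule tendsto_lowerbound) (auto simp: xy)
  then have "a \<noteq> b" using \<open>\<epsilon> > 0\<close> by auto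
  moreover have "a \<in> X" "b \<in> X" using l(1) ab by auto
  ultimately obtain N M U V where N: "subcontinuum N" "subcontinuum M" "N \<inter> M = {}" "a \<in> U" "U \<subseteq> N" "b \<in> V" "V \<subseteq> M"
    "openin (top_of_set X) U" "openin (top_of_set X) V"
    using disjoint_small_nhds by metis
  have ev: "eventually (\<lambda>n. z (r n) \<in> W) sequentially"
    if W: "openin (top_of_set X) W" "c \<in> W" "(\<lambda>n. z (r n)) \<longlonglongrightarrow> c" "\<And>n. z n \<in> X" for W c z
  proof -
    obtain O' where O': "open O'" "W = X \<inter> O'" using W(1) by (auto simp: openin_open)
    then have "eventually (\<lambda>n. z (r n) \<in> O') sequentially"
      using topological_tendstoD[OF that(3)] that(2) by auto
    then show ?thesis using O' that(4) by (auto elim: eventually_mono)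
  qed
  have "eventually (\<lambda>n. x (r n) \<in> U \<and> y (r n) \<in> V) sequentially"
    using ev[OF N(8) N(4) lim(1) subsetD[OF BX xy(1)]] ev[OF N(9) N(6) lim(2) subsetD[OF BX xy(2)]]
    by (rule eventually_conj)
  then obtain n where n: "\<And>k. k \<ge> n \<Longrightarrow> x (r k) \<in> U \<and> y (r k) \<in> V"
    unfolding eventually_sequentially by auto
  have "\<exists>C. subcontinuum C \<and> C \<subseteq> B (r k) \<and> x (r k) \<in> C \<and> y (r k) \<in> C" for k
    using subcontinuum_joining_points[OF B(1) B(2) xy(1) xy(2)] by metis
  then obtain C where C: "\<And>k. subcontinuum (C k)" "\<And>k. C k \<subseteq> B (r k)" "\<And>k. x (r k) \<in> C k" "\<And>k. y (r k) \<in> C k"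
    by metis
  have "r n \<noteq> r (Suc n)" using l(2) by (simp add: strict_mono_def less_imp_neq)
  then have disj: "C n \<inter> C (Suc n) = {}" using B(3) C(2) by blast
  show False
    by (rule disjoint_connectors_impossible[OF N(1,2,3) C(1) C(1) disj])
      (use C(3,4)[of n] C(3,4)[of "Suc n"] n[of n] n[of "Suc n"] N(5,7) in auto)
qed

section \<open>Branches, ramification points and endpoints\<close>

definition branch :: "'a \<Rightarrow> 'a \<Rightarrow> 'a set" where
  "branch c x = connected_component_set (X - {c}) x"

lemma branch_component: "x \<in> X \<Longrightarrow> x \<noteq> c \<Longrightarrow> branch c x \<in> components (X - {c})"
  by (simp add: branch_def componentsI)

lemma branch_self: "x \<in> X \<Longrightarrow> x \<noteq> c \<Longrightarrow> x \<in> branch c x"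
  by (simp add: branch_def)

lemma branch_subset: "branch c x \<subseteq> X - {c}"
  unfolding branch_def by (rule connected_component_subset)

lemma connected_branch: "connected (branch c x)"
  by (simp add: branch_def)

lemma branch_eq: "y \<in> branch c x \<Longrightarrow> branch c y = branch c x"
  unfolding branch_def by (metis connected_component_eq)

lemma branch_disjoint: "branch c x \<noteq> branch c y \<Longrightarrow> branch c x \<inter> branch c y = {}"
  using branch_eq by blast

lemma subset_branch: "connected A \<Longrightarrow> A \<subseteq> X \<Longrightarrow> c \<notin> A \<Longrightarrow> x \<in> A \<Longrightarrow> A \<subseteq> branch c x"
  unfolding branch_def by (intro connected_component_maximal) auto

lemma openin_branch: "openin (top_of_set X) (branch c x)"
proof (cases "x \<in> X - {c}")
  case True
  then show ?thesis
    using openin_component[OF _ branch_component[of x c]] by simp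
next
  case False
  then have "branch c x = {}" unfolding branch_def connected_component_eq_empty .
  then show ?thesis by simp
qed

lemma closed_Diff_branch: "closed (X - branch c x)"
proof -
  obtain W where "open W" "branch c x = X \<inter> W"
    using openin_branch[of c x] by (auto simp: openin_open)
  then have "X - branch c x = X - W" by auto
  then show ?thesis
    using \<open>open W\<close> compact_X by (simp add: closed_Diff compact_imp_closed)
qed

lemma connected_insert_branch:
  assumes "c \<in> X" "x \<in> X" "x \<noteq> c"
  shows "connected (insert c (branch c x))"
proof -
  obtain y where y: "closure (branch c x) \<inter> {c} = {y}"
    using component_attached_at_one_point[OF subcontinuum_singleton[OF assms(1)] _ branch_component[OF assms(2,3)]]
    by auto
  have "y \<in> closure (branch c x) \<inter> {c}" unfolding y by simp
  then have "c \<in> closure (branch c x)" by blast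
  then have "insert c (branch c x) \<subseteq> closure (branch c x)"
    by (intro insert_subsetI closure_subset)
  then show ?thesis
    by (rule connected_intermediate_closure[OF connected_branch subset_insertI])
qed

text \<open>
  The complement of a branch at \<open>c\<close> is the union of \<open>c\<close> with the other branches, each of which has
  \<open>c\<close> in its closure.
\<close>

lemma subcontinuum_Diff_branch:
  assumes "c \<in> X"
  shows "subcontinuum (X - branch c x)"
proof -
  let ?S = "insert {c} ((\<lambda>y. insert c (branch c y)) ` (X - branch c x - {c}))"
  have "\<Union>?S = X - branch c x"
  proof (intro equalityI subsetI)
    fix z assume "z \<in> \<Union>?S"
    then consider "z = c" | y where "y \<in> X" "y \<notin> branch c x" "y \<noteq> c" "z \<in> branch c y" by (auto split: if_splits)
    then show "z \<in> X - branch c x"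
    proof cases
      case 1 then show ?thesis using assms branch_subset by auto
    next
      case 2
      then have "branch c y \<inter> branch c x = {}"
        using branch_self branch_disjoint by metis
      then show ?thesis using 2 branch_subset by blast
    qed
  next
    fix z assume "z \<in> X - branch c x"
    then show "z \<in> \<Union>?S" using branch_self by (cases "z = c") auto
  qed
  moreover have "connected (\<Union>?S)"
  proof (rule connected_Union)
    show "connected s" if "s \<in> ?S" for s
      using that connected_insert_branch[OF assms] by auto
    show "\<Inter>?S \<noteq> {}" by auto
  qed
  ultimately show ?thesis
    using closed_Diff_branch by (simp add: subcontinuum_def)
qed

text \<open>
  In a dendrite this is the arc from \<open>p\<close> to \<open>q\<close>.
\<close>

definition segment :: "'a \<Rightarrow> 'a \<Rightarrow> 'a set" where
  "segment p q = X \<inter> \<Inter>{A. subcontinuum A \<and> p \<in> A \<and> q \<in> A}"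

lemma subcontinuum_segment: "subcontinuum (segment p q)"
  unfolding segment_def by (rule subcontinuum_Inter) simp

lemma segment_ends: "p \<in> X \<Longrightarrow> q \<in> X \<Longrightarrow> p \<in> segment p q \<and> q \<in> segment p q"
  by (auto simp: segment_def)

lemma segment_subset: "subcontinuum A \<Longrightarrow> p \<in> A \<Longrightarrow> q \<in> A \<Longrightarrow> segment p q \<subseteq> A"
  by (auto simp: segment_def)

text \<open>
  If \<open>p\<close> and \<open>q\<close> were in the same branch at \<open>m\<close>, a subcontinuum inside this branch would contain both
  of them, but not \<open>m\<close>.
\<close>

lemma segment_separates:
  assumes "m \<in> segment p q" "p \<in> X" "q \<in> X" "p \<noteq> m" "q \<noteq> m"
  shows "branch m p \<noteq> branch m q"
proof
  assume eq: "branch m p = branch m q"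
  have "p \<in> branch m p" "q \<in> branch m p"
    using branch_self[OF assms(2,4)] branch_self[OF assms(3,5)] unfolding eq by blast+
  then obtain C where C: "subcontinuum C" "C \<subseteq> branch m p" "p \<in> C" "q \<in> C"
    using subcontinuum_joining_points[OF openin_branch connected_branch] by metis
  then have "m \<in> C" using assms(1) segment_subset[OF C(1,3,4)] by auto
  then show False using C(2) branch_subset by auto
qed

text \<open>
  The assumptions on branches say that none of the three points separates the other two, so they do not
  lie on an arc. By Helly's theorem the three segments between them share a point \<open>m\<close>, the
  centre of the tripod that they span.
\<close>

lemma median:
  assumes Y: "subcontinuum Y" "p \<in> Y" "q \<in> Y" "r \<in> Y" and ne: "p \<noteq> q" "p \<noteq> r" "q \<noteq> r"
    and "branch p q = branch p r" "branch q p = branch q r" "branch r p = branch r q"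
  obtains m where "m \<in> Y" "m \<noteq> p" "m \<noteq> q" "m \<noteq> r"
    "branch m p \<noteq> branch m q" "branch m p \<noteq> branch m r" "branch m q \<noteq> branch m r"
proof -
  have X: "p \<in> X" "q \<in> X" "r \<in> X" using Y by (auto simp: subcontinuum_def)
  have "segment p q \<inter> segment p r \<inter> segment q r \<noteq> {}"
    using X segment_ends by (intro helly_three subcontinuum_segment) blast+
  then obtain m where m: "m \<in> segment p q" "m \<in> segment p r" "m \<in> segment q r" by auto
  have "m \<noteq> p" using segment_separates[OF m(3)] X assms by auto
  moreover have "m \<noteq> q" using segment_separates[OF m(2)] X assms by auto
  moreover have "m \<noteq> r" using segment_separates[OF m(1)] X assms by auto
  moreover have "m \<in> Y" using m segment_subset Y by blast
  ultimately show ?thesis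
    using that[of m] segment_separates[OF m(1)] segment_separates[OF m(2)] segment_separates[OF m(3)] X by auto
qed

definition ramification_point :: "'a set \<Rightarrow> 'a \<Rightarrow> bool" where
  "ramification_point Y m \<longleftrightarrow> m \<in> Y \<and> (\<exists>p\<in>Y-{m}. \<exists>q\<in>Y-{m}. \<exists>r\<in>Y-{m}.
     branch m p \<noteq> branch m q \<and> branch m p \<noteq> branch m r \<and> branch m q \<noteq> branch m r)"

definition endpoint :: "'a set \<Rightarrow> 'a \<Rightarrow> bool" where
  "endpoint Y e \<longleftrightarrow> e \<in> Y \<and> (\<forall>x\<in>Y-{e}. \<forall>y\<in>Y-{e}. branch e x = branch e y)"

lemma no_three_endpoints:
  assumes Y: "subcontinuum Y" and no_ram: "\<nexists>m. ramification_point Y m"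
    and "endpoint Y p" "endpoint Y q" "endpoint Y r"
  shows "p = q \<or> p = r \<or> q = r"
proof (rule ccontr)
  assume ne: "\<not> ?thesis"
  have in_Y: "p \<in> Y" "q \<in> Y" "r \<in> Y" using assms by (auto simp: endpoint_def)
  obtain m where "m \<in> Y" "m \<noteq> p" "m \<noteq> q" "m \<noteq> r"
    "branch m p \<noteq> branch m q" "branch m p \<noteq> branch m r" "branch m q \<noteq> branch m r"
  proof (rule median[OF Y in_Y])
    show "branch p q = branch p r" "branch q p = branch q r" "branch r p = branch r q"
      using assms(3-5) in_Y ne unfolding endpoint_def by blast+
  qed (use ne in blast)+
  then show False using no_ram in_Y unfolding ramification_point_def by blast
qed

text \<open>
  Think of \<open>Y\<close> as directed away from \<open>c\<close>. The set \<open>L x\<close> consists of what lies at or beyond \<open>x\<close>. Without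
  ramification points in \<open>Y\<close> any two of the sets \<open>L x\<close> for \<open>x\<close> in \<open>Y \<inter> B\<close> are
  comparable, so Helly's theorem provides a point of \<open>Y\<close> that lies beyond all points of \<open>Y \<inter> B\<close>.
\<close>

lemma endpoint_in_branch:
  assumes Y: "subcontinuum Y" and no_ram: "\<nexists>m. ramification_point Y m"
    and c: "c \<in> Y" and p: "p \<in> Y" "p \<noteq> c"
  obtains e where "endpoint Y e" "e \<in> branch c p"
proof -
  define B where "B = branch c p"
  define L where "L x = X - branch x c" for x
  have YX: "Y \<subseteq> X" using Y by (simp add: subcontinuum_def)
  have L: "subcontinuum (L x)" if "x \<in> X" for x
    unfolding L_def using that by (rule subcontinuum_Diff_branch)
  have xL: "x \<in> L x" if "x \<in> X" for x
    using that branch_subset by (auto simp: L_def)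
  have cB: "c \<notin> B" using branch_subset by (auto simp: B_def)
  have LB: "L x \<subseteq> B" if x: "x \<in> Y \<inter> B" for x
  proof -
    have "c \<noteq> x" using cB x by auto
    then have "c \<notin> L x" using branch_self[of c x] c YX by (auto simp: L_def)
    then have "L x \<subseteq> branch c x"
      using L[of x] xL[of x] x YX by (intro subset_branch) (auto simp: subcontinuum_def)
    then show ?thesis using branch_eq x by (auto simp: B_def)
  qed
  \<comment> \<open>If neither \<open>x\<close> nor \<open>y\<close> lies beyond the other, then none of \<open>c\<close>, \<open>x\<close>, \<open>y\<close> separates the other two.\<close>
  have nested: "x \<in> L y \<or> y \<in> L x" if x: "x \<in> Y \<inter> B" and y: "y \<in> Y \<inter> B" for x y
  proof (rule ccontr)
    assume "\<not> ?thesis"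
    then have xy: "x \<in> branch y c" "y \<in> branch x c" using x y YX by (auto simp: L_def)
    have ne: "c \<noteq> x" "c \<noteq> y" "x \<noteq> y" using cB x y xy branch_subset by auto
    obtain m where "m \<in> Y" "m \<noteq> c" "m \<noteq> x" "m \<noteq> y"
      "branch m c \<noteq> branch m x" "branch m c \<noteq> branch m y" "branch m x \<noteq> branch m y"
    proof (rule median[OF Y c _ _ ne])
      show "branch c x = branch c y" using x y branch_eq by (auto simp: B_def)
      show "branch x c = branch x y" using xy branch_eq by auto
      show "branch y c = branch y x" using xy branch_eq by auto
    qed (use x y in auto)
    then show False using no_ram c x y unfolding ramification_point_def by blast
  qed
  have "X \<inter> \<Inter>(insert Y (L ` (Y \<inter> B))) \<noteq> {}"
  proof (rule helly)
    show "subcontinuum A" if "A \<in> insert Y (L ` (Y \<inter> B))" for A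
      using that Y L YX by auto
    have "Y \<inter> L x \<noteq> {}" if "x \<in> Y \<inter> B" for x using that xL YX by auto
    moreover have "L x \<inter> L y \<noteq> {}" if "x \<in> Y \<inter> B" "y \<in> Y \<inter> B" for x y
      using nested[OF that] xL that YX by auto
    ultimately show "A \<inter> A' \<noteq> {}" if "A \<in> insert Y (L ` (Y \<inter> B))" "A' \<in> insert Y (L ` (Y \<inter> B))" for A A'
      using that c by (auto simp: Int_commute)
  qed
  then obtain e where e: "e \<in> Y" "\<And>x. x \<in> Y \<inter> B \<Longrightarrow> e \<in> L x" by auto
  have "p \<in> B" using branch_self p YX by (auto simp: B_def)
  then have eB: "e \<in> B" using e(2) LB p by auto
  have "branch e y = branch e c" if y: "y \<in> Y" "y \<noteq> e" for y
  proof (rule ccontr)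
    assume ne: "branch e y \<noteq> branch e c"
    then have ye: "y \<notin> branch e c" using branch_eq by auto
    then have "y \<in> L e" using y YX by (auto simp: L_def)
    then have yB: "y \<in> Y \<inter> B" using LB[of e] e eB y by auto
    have ce: "c \<noteq> e" using cB eB by auto
    have "insert e (branch e c) \<subseteq> branch y c"
    proof (rule subset_branch)
      show "connected (insert e (branch e c))"
        using c e YX ce by (intro connected_insert_branch) auto
      show "insert e (branch e c) \<subseteq> X" using e YX branch_subset by blast
      show "y \<notin> insert e (branch e c)" using ye y by auto
      show "c \<in> insert e (branch e c)" using branch_self c YX ce by auto
    qed
    then show False using e(2)[OF yB] by (auto simp: L_def)
  qed
  then have "endpoint Y e" using e by (auto simp: endpoint_def)
  then show ?thesis using that eB by (auto simp: B_def)
qed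

text \<open>
  A point strictly between two points of \<open>Y\<close> has an endpoint of \<open>Y\<close> on either side, and a third endpoint
  would span a tripod with these two.
\<close>

lemma two_endpoints:
  assumes Y: "subcontinuum Y" and no_ram: "\<nexists>m. ramification_point Y m"
    and pq: "p \<in> Y" "q \<in> Y" "p \<noteq> q"
  obtains e e' where "e \<noteq> e'" "endpoint Y e" "endpoint Y e'" "\<And>f. endpoint Y f \<Longrightarrow> f = e \<or> f = e'"
proof -
  have X: "p \<in> X" "q \<in> X" using Y pq by (auto simp: subcontinuum_def)
  \<comment> \<open>A connected set with two points is infinite, so there is a point strictly between \<open>p\<close> and \<open>q\<close>.\<close>
  have "infinite (segment p q)"
    using connected_finite_iff_sing[of "segment p q"] subcontinuum_segment[of p q] segment_ends[OF X] pq(3)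
    by (auto simp: subcontinuum_def)
  then have "segment p q - {p,q} \<noteq> {}"
    by (metis finite.emptyI finite.insertI finite_Diff2)
  then obtain c where c: "c \<in> segment p q" "c \<noteq> p" "c \<noteq> q" by auto
  then have "branch c p \<noteq> branch c q" using segment_separates X by auto
  moreover have "c \<in> Y" using c segment_subset[OF Y pq(1,2)] by auto
  moreover obtain e where "endpoint Y e" "e \<in> branch c p"
    using endpoint_in_branch[OF Y no_ram \<open>c \<in> Y\<close> pq(1)] c by auto
  moreover obtain e' where "endpoint Y e'" "e' \<in> branch c q"
    using endpoint_in_branch[OF Y no_ram \<open>c \<in> Y\<close> pq(2)] c by auto
  ultimately show ?thesis
    using that[of e e'] branch_disjoint[of c p q] no_three_endpoints[OF Y no_ram] by blast
qed

end

section \<open>Group actions on unicoherent continua\<close>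

locale tree_continuum_action = tree_continuum X + group_action G X \<phi>
  for X :: "'a::metric_space set" and G :: "('g, 'm) monoid_scheme" (structure) and \<phi> :: "'g \<Rightarrow> 'a \<Rightarrow> 'a" +
  assumes continuous_act: "g \<in> carrier G \<Longrightarrow> continuous_on X (\<phi> g)"
begin

lemma group_G: "group G"
  using group_hom group_hom.axioms(1) by blast

lemma inv_closed_G: "g \<in> carrier G \<Longrightarrow> inv g \<in> carrier G"
  by (rule group.inv_closed[OF group_G])

lemma mult_closed_G: "g \<in> carrier G \<Longrightarrow> h \<in> carrier G \<Longrightarrow> g \<otimes> h \<in> carrier G"
  by (meson group_G group.is_monoid monoid.m_closed)

lemma one_closed_G: "\<one> \<in> carrier G"
  by (meson group_G group.is_monoid monoid.one_closed)

lemma act_in: "g \<in> carrier G \<Longrightarrow> x \<in> X \<Longrightarrow> \<phi> g x \<in> X"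
  using element_image by blast

lemma act_inv: "g \<in> carrier G \<Longrightarrow> x \<in> X \<Longrightarrow> \<phi> (inv g) (\<phi> g x) = x"
  using orbit_sym_aux by blast

lemma act_one: "x \<in> X \<Longrightarrow> \<phi> \<one> x = x"
  using id_eq_one by (metis restrict_apply')

lemma act_inv': "g \<in> carrier G \<Longrightarrow> x \<in> X \<Longrightarrow> \<phi> g (\<phi> (inv g) x) = x"
  using act_inv[OF inv_closed_G] group.inv_inv[OF group_G] by simp

lemma act_image_subset: "g \<in> carrier G \<Longrightarrow> A \<subseteq> X \<Longrightarrow> \<phi> g ` A \<subseteq> X"
  using act_in by blast

lemma act_image_one: "A \<subseteq> X \<Longrightarrow> \<phi> \<one> ` A = A"
  using act_one by (auto simp: subset_iff image_iff)

lemma act_image_mult: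
  assumes "g \<in> carrier G" "h \<in> carrier G" "A \<subseteq> X"
  shows "\<phi> (g \<otimes> h) ` A = \<phi> g ` \<phi> h ` A"
  unfolding image_image
  by (rule image_cong) (use assms in \<open>auto intro!: composition_rule\<close>)

lemma act_image_inv': "g \<in> carrier G \<Longrightarrow> A \<subseteq> X \<Longrightarrow> \<phi> g ` \<phi> (inv g) ` A = A"
  using act_inv' unfolding image_image by (simp add: subset_iff cong: image_cong_simp)

lemma act_image_Int:
  "g \<in> carrier G \<Longrightarrow> A \<subseteq> X \<Longrightarrow> B \<subseteq> X \<Longrightarrow> \<phi> g ` (A \<inter> B) = \<phi> g ` A \<inter> \<phi> g ` B"
  using inj_prop by (intro inj_on_image_Int)

lemma act_image_Diff:
  "g \<in> carrier G \<Longrightarrow> A \<subseteq> X \<Longrightarrow> \<phi> g ` (X - A) = X - \<phi> g ` A"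
  using inj_on_image_set_diff[OF inj_prop, of g X A] surj_prop by auto

lemma homeomorphism_act: "g \<in> carrier G \<Longrightarrow> homeomorphism X X (\<phi> g) (\<phi> (inv g))"
  unfolding homeomorphism_def
  using continuous_act inv_closed_G surj_prop act_inv act_inv' by auto

lemma subcontinuum_act: "g \<in> carrier G \<Longrightarrow> subcontinuum A \<Longrightarrow> subcontinuum (\<phi> g ` A)"
  unfolding subcontinuum_def
  using compact_X continuous_act act_image_subset
  by (metis compact_Int_closed compact_continuous_image compact_imp_closed
      connected_continuous_image continuous_on_subset inf.absorb_iff2)

lemma connected_component_act:
  assumes g: "g \<in> carrier G" and Y: "Y \<subseteq> X" and x: "x \<in> X - Y"
  shows "\<phi> g ` connected_component_set (X - Y) x = connected_component_set (X - \<phi> g ` Y) (\<phi> g x)"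
proof -
  have "homeomorphism (X - Y) (X - \<phi> g ` Y) (\<phi> g) (\<phi> (inv g))"
    by (rule homeomorphism_of_subsets[OF homeomorphism_act[OF g]]) (use act_image_Diff[OF g Y] in auto)
  then show ?thesis using connected_component_set_homeomorphism x by metis
qed

lemma branch_act:
  assumes "g \<in> carrier G" "c \<in> X" "x \<in> X" "x \<noteq> c"
  shows "\<phi> g ` branch c x = branch (\<phi> g c) (\<phi> g x)"
  using connected_component_act[of g "{c}" x] assms by (simp add: branch_def)

lemma openin_act:
  assumes "g \<in> carrier G" "openin (top_of_set X) U"
  shows "openin (top_of_set X) (\<phi> g ` U)"
  using homeomorphism_imp_open_map[OF homeomorphism_act[OF assms(1)] assms(2)] .

text \<open>
  Inclusion under all group elements suffices, since it applies to inverses as well.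
\<close>

lemma invariantI:
  assumes "A \<subseteq> X" "\<And>g. g \<in> carrier G \<Longrightarrow> \<phi> g ` A \<subseteq> A"
  shows "invariant_set G \<phi> A"
  unfolding invariant_set_def
proof (intro ballI equalityI)
  fix g assume g: "g \<in> carrier G"
  have "A = \<phi> g ` \<phi> (inv g) ` A" using act_image_inv'[OF g assms(1)] by simp
  also have "\<dots> \<subseteq> \<phi> g ` A" by (rule image_mono[OF assms(2)[OF inv_closed_G[OF g]]])
  finally show "A \<subseteq> \<phi> g ` A" .
qed (use assms in blast)

text \<open>
  The component of \<open>X - Y\<close> containing \<open>Z\<close> is invariant, hence so is the single point at which it is
  attached to \<open>Y\<close>.
\<close>

lemma disjoint_invariant_subcontinua_fixed_point:
  assumes Y: "subcontinuum Y" "Y \<noteq> {}" "invariant_set G \<phi> Y"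
    and Z: "subcontinuum Z" "Z \<noteq> {}" "invariant_set G \<phi> Z" and "Y \<inter> Z = {}"
  shows "\<exists>x\<in>X. \<forall>g\<in>carrier G. \<phi> g x = x"
proof -
  obtain z where z: "z \<in> Z" using Z by auto
  define U where "U = connected_component_set (X - Y) z"
  have YX: "Y \<subseteq> X" and zX: "z \<in> X - Y"
    using z Z Y \<open>Y \<inter> Z = {}\<close> by (auto simp: subcontinuum_def)
  then have U: "U \<in> components (X - Y)" by (simp add: U_def componentsI)
  have ZU: "Z \<subseteq> U"
    unfolding U_def using z Z \<open>Y \<inter> Z = {}\<close>
    by (intro connected_component_maximal) (auto simp: subcontinuum_def)
  obtain y where y: "closure U \<inter> Y = {y}"
    using component_attached_at_one_point[OF Y(1,2) U] by auto
  then have yX: "y \<in> X" "y \<in> closure U" "y \<in> Y" using YX by blast+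
  have "\<phi> g y = y" if g: "g \<in> carrier G" for g
  proof -
    have gY: "\<phi> g ` Y = Y" "\<phi> g ` Z = Z" using Y Z g by (auto simp: invariant_set_def)
    have "\<phi> g ` U = connected_component_set (X - Y) (\<phi> g z)"
      using connected_component_act[OF g YX zX] gY by (simp add: U_def)
    also have "\<phi> g z \<in> U" using gY z ZU by auto
    then have "connected_component_set (X - Y) (\<phi> g z) = U"
      unfolding U_def using connected_component_eq by metis
    finally have gU: "\<phi> g ` U = U" .
    have UX: "closure U \<subseteq> X"
      using in_components_subset[OF U] by (intro closure_subset_X) auto
    have "\<phi> g ` closure U \<subseteq> closure U"
      by (rule image_closure_subset)
        (use continuous_act[OF g] UX gU closure_subset[of U] in \<open>auto intro: continuous_on_subset\<close>)
    then have "\<phi> g y \<in> closure U \<inter> Y" using yX gY by auto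
    then show ?thesis using y by auto
  qed
  then show ?thesis using yX by auto
qed

text \<open>
  The smallest non-empty invariant subcontinuum, provided that there is no fixed point.
\<close>

definition core :: "'a set" where
  "core = X \<inter> \<Inter>{A. subcontinuum A \<and> A \<noteq> {} \<and> invariant_set G \<phi> A}"

lemma core_subset: "subcontinuum A \<Longrightarrow> A \<noteq> {} \<Longrightarrow> invariant_set G \<phi> A \<Longrightarrow> core \<subseteq> A"
  by (auto simp: core_def)

lemma subcontinuum_core: "subcontinuum core"
  unfolding core_def by (rule subcontinuum_Inter) simp

lemma invariant_Inter:
  assumes "\<And>A. A \<in> F \<Longrightarrow> invariant_set G \<phi> A"
  shows "invariant_set G \<phi> (X \<inter> \<Inter>F)"
proof (rule invariantI)
  fix g assume g: "g \<in> carrier G"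
  have "\<phi> g x \<in> A" if "x \<in> A" "A \<in> F" for x A
    using assms[OF that(2)] g that(1) unfolding invariant_set_def by blast
  then show "\<phi> g ` (X \<inter> \<Inter>F) \<subseteq> X \<inter> \<Inter>F" using act_in[OF g] by auto
qed auto

lemma invariant_core: "invariant_set G \<phi> core"
  unfolding core_def by (rule invariant_Inter) simp

lemma core_nonempty:
  assumes "\<nexists>x. x \<in> X \<and> (\<forall>g\<in>carrier G. \<phi> g x = x)"
  shows "core \<noteq> {}"
  unfolding core_def
proof (rule helly)
  fix A B assume "A \<in> {A. subcontinuum A \<and> A \<noteq> {} \<and> invariant_set G \<phi> A}"
    "B \<in> {A. subcontinuum A \<and> A \<noteq> {} \<and> invariant_set G \<phi> A}"
  then show "A \<inter> B \<noteq> {}"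
    using disjoint_invariant_subcontinua_fixed_point[of A B] assms by auto
qed simp

text \<open>
  If every translate of the complement \<open>D\<close> met \<open>D\<close>, then all translates would meet pairwise. By Helly's
  theorem they would share a non-empty invariant subcontinuum, which would contain the core although it
  misses the branch.
\<close>

lemma flip_branch:
  assumes c: "c \<in> X" and meets: "branch c x \<inter> core \<noteq> {}"
  obtains g where "g \<in> carrier G" "\<phi> g ` (X - branch c x) \<subseteq> branch c x"
proof -
  define D where "D = X - branch c x"
  have D: "subcontinuum D" "D \<noteq> {}" "D \<subseteq> X"
    unfolding D_def using c subcontinuum_Diff_branch branch_subset by blast+
  have "\<exists>g\<in>carrier G. \<phi> g ` D \<inter> D = {}"
  proof (rule ccontr)
    assume "\<not> ?thesis"
    then have neg: "\<phi> g ` D \<inter> D \<noteq> {}" if "g \<in> carrier G" for g using that by blast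
    define F where "F = (\<lambda>g. \<phi> g ` D) ` carrier G"
    have Fsub: "subcontinuum A" if "A \<in> F" for A
      using that subcontinuum_act D by (auto simp: F_def)
    have "X \<inter> \<Inter>F \<noteq> {}"
    proof (rule helly[OF Fsub])
      fix A B assume "A \<in> F" "B \<in> F"
      then obtain g h where gh: "g \<in> carrier G" "h \<in> carrier G" "A = \<phi> g ` D" "B = \<phi> h ` D"
        by (auto simp: F_def)
      have k: "inv h \<otimes> g \<in> carrier G" using gh by (simp add: mult_closed_G inv_closed_G)
      have gD: "\<phi> g ` D \<subseteq> X" "\<phi> (inv h) ` \<phi> g ` D \<subseteq> X"
        using act_image_subset[OF gh(1) D(3)] act_image_subset[OF inv_closed_G[OF gh(2)]] by simp_all
      \<comment> \<open>Translate \<open>\<phi> g ` D \<inter> \<phi> h ` D\<close> back by \<open>h\<close> to compare with \<open>D\<close> itself.\<close>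
      have "\<phi> h ` (\<phi> (inv h \<otimes> g) ` D \<inter> D) = \<phi> h ` \<phi> (inv h) ` \<phi> g ` D \<inter> \<phi> h ` D"
        using gh D gD by (simp add: act_image_Int act_image_mult inv_closed_G)
      also have "\<dots> = A \<inter> B" using gh gD by (simp add: act_image_inv')
      finally show "A \<inter> B \<noteq> {}" using neg[OF k] by auto
    qed
    moreover have "invariant_set G \<phi> (X \<inter> \<Inter>F)"
    proof (rule invariantI)
      fix g assume g: "g \<in> carrier G"
      have "\<phi> g x \<in> \<phi> h ` D" if x: "x \<in> X \<inter> \<Inter>F" and h: "h \<in> carrier G" for x h
      proof -
        have "x \<in> \<phi> (inv g \<otimes> h) ` D"
          using x g h by (auto simp: F_def mult_closed_G inv_closed_G)
        then have "\<phi> g x \<in> \<phi> g ` \<phi> (inv g) ` \<phi> h ` D"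
          using g h D by (simp add: act_image_mult inv_closed_G)
        then show ?thesis using act_image_inv'[OF g] act_image_subset[OF h D(3)] by simp
      qed
      then show "\<phi> g ` (X \<inter> \<Inter>F) \<subseteq> X \<inter> \<Inter>F"
        using act_in[OF g] unfolding F_def by blast
    qed auto
    ultimately have "core \<subseteq> X \<inter> \<Inter>F"
      using core_subset subcontinuum_Inter[OF Fsub] by blast
    moreover have "D \<in> F"
      unfolding F_def using act_image_one[OF D(3)] one_closed_G by (metis imageI)
    ultimately have "core \<subseteq> D" by auto
    then show False using meets by (auto simp: D_def)
  qed
  then obtain g where g: "g \<in> carrier G" "\<phi> g ` D \<inter> D = {}" by auto
  then have "\<phi> g ` D \<subseteq> branch c x"
    using act_image_subset[OF g(1) D(3)] by (auto simp: D_def)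
  then show ?thesis using that g(1) by (simp add: D_def)
qed

definition squeezable_complement :: "'a set \<Rightarrow> bool" where
  "squeezable_complement B \<longleftrightarrow> (\<forall>\<epsilon>>0. \<exists>g\<in>carrier G. \<forall>x\<in>X - B. \<forall>y\<in>X - B. dist (\<phi> g x) (\<phi> g y) < \<epsilon>)"

text \<open>
  Ping-pong with three branches \<open>P\<close>, \<open>Q\<close> and \<open>R\<close> at \<open>m\<close>. The product \<open>k\<close> of the flips of \<open>P\<close> and \<open>Q\<close> maps
  everything outside \<open>Q\<close> into \<open>P\<close>, in particular both \<open>P\<close> and \<open>R\<close>. So the positive powers of \<open>k\<close> move
  \<open>R\<close> into \<open>P\<close>, off itself, and the translates of \<open>R\<close> under the powers of \<open>k\<close> are pairwise disjoint. Their
  diameters tend to zero, and the flip of \<open>R\<close> followed by a power of \<open>k\<close> maps \<open>X - R\<close> into one of them.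
\<close>

lemma contraction_of_ramification:
  assumes "ramification_point core m"
  obtains B h where "openin (top_of_set X) B" "\<And>n::nat. h n \<in> carrier G"
    "\<And>i j. i \<noteq> j \<Longrightarrow> \<phi> (h i) ` B \<inter> \<phi> (h j) ` B = {}"
    "squeezable_complement B"
proof -
  have coreX: "core \<subseteq> X" using subcontinuum_core by (simp add: subcontinuum_def)
  obtain p q r where pqr: "m \<in> core" "p \<in> core - {m}" "q \<in> core - {m}" "r \<in> core - {m}"
     "branch m p \<noteq> branch m q" "branch m p \<noteq> branch m r" "branch m q \<noteq> branch m r"
    using assms unfolding ramification_point_def by blast
  have mX: "m \<in> X" using pqr coreX by auto
  define P Q R where "P = branch m p" and "Q = branch m q" and "R = branch m r"
  have meets: "branch m x \<inter> core \<noteq> {}" if "x \<in> core - {m}" for x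
    using that branch_self[of x m] coreX by auto
  obtain f1 where f1: "f1 \<in> carrier G" "\<phi> f1 ` (X - P) \<subseteq> P"
    using flip_branch[OF mX meets[OF pqr(2)]] unfolding P_def by blast
  obtain f2 where f2: "f2 \<in> carrier G" "\<phi> f2 ` (X - Q) \<subseteq> Q"
    using flip_branch[OF mX meets[OF pqr(3)]] unfolding Q_def by blast
  obtain f3 where f3: "f3 \<in> carrier G" "\<phi> f3 ` (X - R) \<subseteq> R"
    using flip_branch[OF mX meets[OF pqr(4)]] unfolding R_def by blast
  have disj: "P \<inter> Q = {}" "P \<inter> R = {}" "Q \<inter> R = {}"
    using branch_disjoint pqr by (auto simp: P_def Q_def R_def)
  have sub: "P \<subseteq> X" "Q \<subseteq> X" "R \<subseteq> X"
    using branch_subset by (auto simp: P_def Q_def R_def)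
  define k where "k = f1 \<otimes> f2"
  have k: "k \<in> carrier G" using f1 f2 by (simp add: k_def mult_closed_G)
  \<comment> \<open>The second flip maps \<open>X - Q\<close> into \<open>Q\<close>, which lies outside \<open>P\<close>; the first one maps this into \<open>P\<close>.\<close>
  have kP: "\<phi> k ` A \<subseteq> P" if A: "A \<subseteq> X - Q" for A
  proof -
    have "\<phi> k ` A = \<phi> f1 ` \<phi> f2 ` A"
      unfolding k_def using A f1 f2 by (intro act_image_mult) auto
    also have "\<dots> \<subseteq> \<phi> f1 ` \<phi> f2 ` (X - Q)" using A by (intro image_mono)
    also have "\<dots> \<subseteq> \<phi> f1 ` (X - P)" using f2 disj sub by (intro image_mono) auto
    also have "\<dots> \<subseteq> P" by (rule f1)
    finally show ?thesis .
  qed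
  define h where "h = rec_nat \<one> (\<lambda>_ g. k \<otimes> g)"
  have h0: "h 0 = \<one>" and hS: "h (Suc n) = k \<otimes> h n" for n by (simp_all add: h_def)
  have hG: "h n \<in> carrier G" for n
    by (induction n) (auto simp: h0 hS k one_closed_G mult_closed_G)
  have himage: "\<phi> (h (Suc n)) ` R = \<phi> k ` \<phi> (h n) ` R" for n
    unfolding hS using k hG sub by (intro act_image_mult) auto
  have hR0: "\<phi> (h 0) ` R = R" using act_image_one sub by (simp add: h0)
  have hRP: "\<phi> (h (Suc n)) ` R \<subseteq> P" for n
  proof (induction n)
    case 0 show ?case unfolding himage hR0 using disj sub by (intro kP) auto
  next
    case (Suc n) then show ?case unfolding himage[of "Suc n"] using disj sub by (intro kP) auto
  qed
  have hRX: "\<phi> (h n) ` R \<subseteq> X" for n using act_image_subset hG sub by blast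
  have lt: "\<phi> (h i) ` R \<inter> \<phi> (h (i + Suc d)) ` R = {}" for i d
  proof (induction i)
    case 0 show ?case using hRP[of d] hR0 disj by auto
  next
    case (Suc i)
    have "\<phi> (h (Suc i)) ` R \<inter> \<phi> (h (Suc i + Suc d)) ` R = \<phi> k ` (\<phi> (h i) ` R \<inter> \<phi> (h (i + Suc d)) ` R)"
      using himage[of i] himage[of "i + Suc d"] act_image_Int[OF k hRX hRX] by simp
    then show ?case using Suc by simp
  qed
  have hdisj: "\<phi> (h i) ` R \<inter> \<phi> (h j) ` R = {}" if "i \<noteq> j" for i j
  proof (cases "i < j")
    case True
    then show ?thesis using lt[of i "j - Suc i"] by simp
  next
    case False
    then show ?thesis using lt[of j "i - Suc j"] that by (simp add: Int_commute)
  qed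
  have openR: "openin (top_of_set X) R" by (simp add: R_def openin_branch)
  have "squeezable_complement R"
    unfolding squeezable_complement_def
  proof (intro allI impI)
    fix \<epsilon> :: real assume "\<epsilon> > 0"
    have "\<exists>n. \<forall>x\<in>\<phi> (h n) ` R. \<forall>y\<in>\<phi> (h n) ` R. dist x y < \<epsilon>"
    proof (rule disjoint_connected_sets_null[OF _ _ hdisj \<open>\<epsilon> > 0\<close>])
      show "openin (top_of_set X) (\<phi> (h n) ` R)" for n
        using openin_act[OF hG openR] .
      show "connected (\<phi> (h n) ` R)" for n
        using continuous_on_subset[OF continuous_act[OF hG] sub(3)] connected_branch
        by (intro connected_continuous_image) (auto simp: R_def)
    qed
    then obtain n where n: "\<forall>x\<in>\<phi> (h n) ` R. \<forall>y\<in>\<phi> (h n) ` R. dist x y < \<epsilon>" by auto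
    show "\<exists>g\<in>carrier G. \<forall>x\<in>X - R. \<forall>y\<in>X - R. dist (\<phi> g x) (\<phi> g y) < \<epsilon>"
    proof (intro bexI[of _ "h n \<otimes> f3"] ballI)
      fix x y assume "x \<in> X - R" "y \<in> X - R"
      then have "\<phi> f3 x \<in> R" "\<phi> f3 y \<in> R" using f3 by auto
      then show "dist (\<phi> (h n \<otimes> f3) x) (\<phi> (h n \<otimes> f3) y) < \<epsilon>"
        using n \<open>x \<in> X - R\<close> \<open>y \<in> X - R\<close> hG f3 by (simp add: composition_rule)
    qed (use hG f3 mult_closed_G in blast)
  qed
  then show ?thesis using that[of R h] openR hG hdisj by blast
qed

lemma endpoint_act:
  assumes Y: "Y \<subseteq> X" "invariant_set G \<phi> Y" and e: "endpoint Y e" and g: "g \<in> carrier G"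
  shows "endpoint Y (\<phi> g e)"
  unfolding endpoint_def
proof (intro conjI ballI)
  have gY: "\<phi> g ` Y = Y" "\<phi> (inv g) ` Y = Y" using Y g inv_closed_G by (auto simp: invariant_set_def)
  have eY: "e \<in> Y" "e \<in> X" using e Y by (auto simp: endpoint_def)
  then show "\<phi> g e \<in> Y" using gY by auto
  have *: "branch (\<phi> g e) x = \<phi> g ` branch e (\<phi> (inv g) x) \<and> \<phi> (inv g) x \<in> Y - {e}"
    if x: "x \<in> Y - {\<phi> g e}" for x
  proof -
    have xX: "x \<in> X" using x Y by auto
    have x': "\<phi> (inv g) x \<in> Y" using x gY by auto
    moreover have ne: "\<phi> (inv g) x \<noteq> e" using act_inv'[OF g xX] x by auto
    moreover have "branch (\<phi> g e) (\<phi> g (\<phi> (inv g) x)) = \<phi> g ` branch e (\<phi> (inv g) x)"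
      using branch_act[OF g eY(2) _ ne] x' Y by auto
    ultimately show ?thesis using act_inv'[OF g xX] by simp
  qed
  fix x y assume "x \<in> Y - {\<phi> g e}" "y \<in> Y - {\<phi> g e}"
  then show "branch (\<phi> g e) x = branch (\<phi> g e) y"
    using *[of x] *[of y] e unfolding endpoint_def by metis
qed

text \<open>
  Without ramification points the core has exactly two endpoints, and these form an invariant pair.
\<close>

theorem core_ramifies:
  assumes "\<not> elementary_action G X \<phi>"
  obtains m where "ramification_point core m"
proof (rule ccontr)
  assume "\<not> thesis"
  then have no_ram: "\<nexists>m. ramification_point core m" using that by blast
  have no_fix: "\<nexists>x. x \<in> X \<and> (\<forall>g\<in>carrier G. \<phi> g x = x)"
    using assms by (auto simp: elementary_action_def)
  have coreX: "core \<subseteq> X" using subcontinuum_core by (simp add: subcontinuum_def)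
  have core_inv: "\<phi> g ` core = core" if "g \<in> carrier G" for g
    using invariant_core that by (simp add: invariant_set_def)
  obtain p where p: "p \<in> core" using core_nonempty[OF no_fix] by auto
  have "\<not> core \<subseteq> {p}"
  proof
    assume "core \<subseteq> {p}"
    then have "core = {p}" using p by auto
    then have "\<phi> g p = p" if "g \<in> carrier G" for g using core_inv[OF that] by simp
    then show False using no_fix p coreX by auto
  qed
  then obtain q where q: "q \<in> core" "p \<noteq> q" by auto
  obtain e e' where e: "e \<noteq> e'" "endpoint core e" "endpoint core e'" "\<And>f. endpoint core f \<Longrightarrow> f = e \<or> f = e'"
    by (fact two_endpoints[OF subcontinuum_core no_ram p q])
  have eX: "e \<in> X" "e' \<in> X" using e coreX by (auto simp: endpoint_def)
  have "\<phi> g ` {e, e'} = {e, e'}" if g: "g \<in> carrier G" for g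
  proof -
    have "\<phi> g e \<in> {e,e'}" "\<phi> g e' \<in> {e,e'}"
      using e(4) endpoint_act[OF coreX invariant_core e(2) g] endpoint_act[OF coreX invariant_core e(3) g] by auto
    moreover have "\<phi> g e \<noteq> \<phi> g e'"
      using inj_onD[OF inj_prop[OF g] _ eX] e(1) by auto
    ultimately show ?thesis by auto
  qed
  then have "elementary_action G X \<phi>"
    unfolding elementary_action_def using eX e(1) by blast
  then show False using assms by simp
qed

end

section \<open>Minimality and strong proximality\<close>

lemma (in finite_measure) measure_disjoint_family_tendsto_zero:
  assumes "range A \<subseteq> sets M" "disjoint_family A"
  shows "(\<lambda>n::nat. measure M (A n)) \<longlonglongrightarrow> 0"
  using finite_measure_UNION[OF assms] by (intro summable_LIMSEQ_zero) (rule sums_summable)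

text \<open>
  If \<open>f\<close> is within \<open>\<eta>\<close> of \<open>c\<close> off a set \<open>E\<close>, then the mean of \<open>f\<close> is off by at most \<open>\<eta>\<close> plus what \<open>E\<close> can
  contribute. This controls the integral of a test function against a measure that is almost
  concentrated in a small ball.
\<close>

lemma (in prob_space) abs_integral_minus_const_le:
  fixes f :: "'a \<Rightarrow> real"
  assumes f: "f \<in> borel_measurable M" and E: "E \<in> sets M" and "0 \<le> \<eta>" "0 \<le> C"
    and C: "\<And>x. x \<in> space M \<Longrightarrow> \<bar>f x - c\<bar> \<le> C"
    and off: "\<And>x. x \<in> space M - E \<Longrightarrow> \<bar>f x - c\<bar> \<le> \<eta>"
  shows "\<bar>(\<integral>x. f x \<partial>M) - c\<bar> \<le> \<eta> + C * prob E"
proof -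
  have int: "integrable M (\<lambda>x. f x - c)"
    using f C by (intro integrable_const_bound[where B = C]) auto
  then have "integrable M f"
    using Bochner_Integration.integrable_add[of M "\<lambda>x. f x - c" "\<lambda>_. c"] by simp
  then have "(\<integral>x. f x \<partial>M) - c = (\<integral>x. f x - c \<partial>M)"
    by (simp add: prob_space)
  then have "\<bar>(\<integral>x. f x \<partial>M) - c\<bar> \<le> (\<integral>x. \<bar>f x - c\<bar> \<partial>M)"
    by simp
  also have "\<dots> \<le> (\<integral>x. \<eta> + C * indicator E x \<partial>M)"
  proof (rule integral_mono)
    show "integrable M (\<lambda>x. \<bar>f x - c\<bar>)" using int by simp
    show "integrable M (\<lambda>x. \<eta> + C * indicator E x)"
      using E by (intro Bochner_Integration.integrable_add integrable_mult_right) (auto simp: emeasure_finite less_top[symmetric])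
    show "\<bar>f x - c\<bar> \<le> \<eta> + C * indicator E x" if "x \<in> space M" for x
      using C[OF that] off[of x] that \<open>0 \<le> \<eta>\<close> by (auto simp: indicator_def)
  qed
  also have "\<dots> = \<eta> + C * prob E"
  proof -
    have "integrable M (indicator E :: 'a \<Rightarrow> real)"
      using E by (auto simp: emeasure_finite less_top[symmetric])
    then show ?thesis using E by (simp add: prob_space)
  qed
  finally show ?thesis .
qed

text \<open>
  Convergence of the integrals of continuous functions is convergence in the weak-* topology. The
  topology is given by a subbasis, so this is an induction over the generation of its open sets.
\<close>

lemma eventually_in_weak_star_open:
  assumes "openin (weak_star_topology Y) T" "\<delta> \<in> T"
    and P: "eventually (\<lambda>n. \<nu> n \<in> Prob Y) F"
    and conv: "\<And>f :: 'a::metric_space \<Rightarrow> real. continuous_on Y f \<Longrightarrow> ((\<lambda>n. \<integral>x. f x \<partial>\<nu> n) \<longlongrightarrow> (\<integral>x. f x \<partial>\<delta>)) F"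
  shows "eventually (\<lambda>n. \<nu> n \<in> T) F"
proof -
  let ?S = "{{\<mu> \<in> Prob Y. (\<integral>x. f x \<partial>\<mu>) \<in> U} | (f :: 'a \<Rightarrow> real) U. continuous_on Y f \<and> open U}"
  have "generate_topology_on ?S T"
    using assms(1) unfolding weak_star_topology_def by (rule openin_topology_generated_by)
  then show ?thesis using assms(2)
  proof (induction T)
    case (Int a b)
    then show ?case by (auto intro: eventually_conj)
  next
    case (UN K)
    then obtain k where "k \<in> K" "\<delta> \<in> k" by auto
    then show ?case using UN.IH[of k] by (auto elim: eventually_mono)
  next
    case (Basis s)
    then obtain f :: "'a \<Rightarrow> real" and U where s: "s = {\<mu> \<in> Prob Y. (\<integral>x. f x \<partial>\<mu>) \<in> U}" "continuous_on Y f" "open U"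
      by auto
    have "eventually (\<lambda>n. (\<integral>x. f x \<partial>\<nu> n) \<in> U) F"
      using topological_tendstoD[OF conv[OF s(2)] s(3)] Basis s(1) by auto
    then show ?case using P unfolding s(1) by eventually_elim auto
  qed simp
qed

context tree_continuum_action
begin

text \<open>
  The two products of the ping-pong argument. Together they yield both the uniqueness of the minimal set
  and strong proximality.
\<close>

definition contracting :: "'a set \<Rightarrow> (nat \<Rightarrow> 'g) \<Rightarrow> bool" where
  "contracting B h \<longleftrightarrow> openin (top_of_set X) B \<and> (\<forall>n. h n \<in> carrier G) \<and>
     (\<forall>i j. i \<noteq> j \<longrightarrow> \<phi> (h i) ` B \<inter> \<phi> (h j) ` B = {}) \<and> squeezable_complement B"

lemma non_elementary_contracting:
  assumes "\<not> elementary_action G X \<phi>"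
  obtains B h where "contracting B h"
proof -
  obtain m where "ramification_point core m" using core_ramifies[OF assms] .
  then show ?thesis
    using contraction_of_ramification[of m] that unfolding contracting_def by metis
qed

text \<open>
  Conjugation moves the contraction from the complement of \<open>B\<close> to the complement of any translate.
\<close>

lemma contract_off_translate:
  assumes "contracting B h" "\<epsilon> > 0"
  obtains k where "k \<in> carrier G"
    "\<And>x y. x \<in> X - \<phi> (h n) ` B \<Longrightarrow> y \<in> X - \<phi> (h n) ` B \<Longrightarrow> dist (\<phi> k x) (\<phi> k y) < \<epsilon>"
proof -
  have h: "h n \<in> carrier G" and BX: "B \<subseteq> X" and con: "squeezable_complement B"
    using assms(1) openin_imp_subset by (auto simp: contracting_def)
  obtain g where g: "g \<in> carrier G" "\<And>x y. x \<in> X - B \<Longrightarrow> y \<in> X - B \<Longrightarrow> dist (\<phi> g x) (\<phi> g y) < \<epsilon>"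
    using con assms(2) unfolding squeezable_complement_def by metis
  have pull: "\<phi> (inv (h n)) x \<in> X - B" if "x \<in> X - \<phi> (h n) ` B" for x
  proof -
    have "\<phi> (inv (h n)) x \<in> X" using that act_in inv_closed_G h by auto
    moreover have "\<phi> (inv (h n)) x \<notin> B"
    proof
      assume "\<phi> (inv (h n)) x \<in> B"
      then have "\<phi> (h n) (\<phi> (inv (h n)) x) \<in> \<phi> (h n) ` B" by simp
      then show False using act_inv'[OF h] that by simp
    qed
    ultimately show ?thesis by simp
  qed
  show ?thesis
  proof
    show "g \<otimes> inv (h n) \<in> carrier G" using g h by (simp add: mult_closed_G inv_closed_G)
    fix x y assume xy: "x \<in> X - \<phi> (h n) ` B" "y \<in> X - \<phi> (h n) ` B"
    then show "dist (\<phi> (g \<otimes> inv (h n)) x) (\<phi> (g \<otimes> inv (h n)) y) < \<epsilon>"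
      using g(2)[OF pull[OF xy(1)] pull[OF xy(2)]] g(1) h inv_closed_G by (simp add: composition_rule)
  qed
qed

text \<open>
  A point of \<open>Y\<close> and a point of \<open>Z\<close> can be brought arbitrarily close, because one of three disjoint
  translates of \<open>B\<close> contains neither of them. But disjoint compact sets have a positive distance.
\<close>

lemma compact_invariant_sets_meet:
  assumes con: "contracting B h"
    and Y: "compact Y" "Y \<subseteq> X" "Y \<noteq> {}" "invariant_set G \<phi> Y"
    and Z: "compact Z" "Z \<subseteq> X" "Z \<noteq> {}" "invariant_set G \<phi> Z"
  shows "Y \<inter> Z \<noteq> {}"
proof
  assume "Y \<inter> Z = {}"
  have "compact ((\<lambda>(y,z). dist y z) ` (Y \<times> Z))"
    by (intro compact_continuous_image compact_Times Y Z) (auto simp: split_beta intro!: continuous_intros)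
  moreover have "(\<lambda>(y,z). dist y z) ` (Y \<times> Z) \<noteq> {}" using Y(3) Z(3) by simp
  ultimately obtain d where d: "d \<in> (\<lambda>(y,z). dist y z) ` (Y \<times> Z)" "\<And>t. t \<in> (\<lambda>(y,z). dist y z) ` (Y \<times> Z) \<Longrightarrow> d \<le> t"
    using compact_attains_inf by metis
  have "d > 0" using d(1) \<open>Y \<inter> Z = {}\<close> by auto
  obtain y z where yz: "y \<in> Y" "z \<in> Z" using Y(3) Z(3) by auto
  have disj: "\<phi> (h i) ` B \<inter> \<phi> (h j) ` B = {}" if "i \<noteq> j" for i j
    using con that by (simp add: contracting_def)
  obtain n where n: "y \<notin> \<phi> (h n) ` B" "z \<notin> \<phi> (h n) ` B"
  proof -
    have "\<phi> (h 0) ` B \<inter> \<phi> (h 1) ` B = {}" "\<phi> (h 0) ` B \<inter> \<phi> (h 2) ` B = {}" "\<phi> (h 1) ` B \<inter> \<phi> (h 2) ` B = {}"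
      by (rule disj, simp)+
    then show ?thesis using that[of 0] that[of 1] that[of 2] by blast
  qed
  obtain k where k: "k \<in> carrier G" "dist (\<phi> k y) (\<phi> k z) < d"
    using contract_off_translate[OF con \<open>d > 0\<close>, of n] n yz Y(2) Z(2) by (metis DiffI subsetD)
  have "\<phi> k y \<in> Y" "\<phi> k z \<in> Z"
    using yz k(1) Y(4) Z(4) unfolding invariant_set_def by blast+
  then have "d \<le> dist (\<phi> k y) (\<phi> k z)" by (intro d(2)) force
  then show False using k(2) by simp
qed

text \<open>
  The canonical compact set. It lies in every non-empty compact invariant set, which yields
  minimality and uniqueness at once.
\<close>

definition limit_set :: "'a set" where
  "limit_set = X \<inter> \<Inter>{A. compact A \<and> A \<subseteq> X \<and> A \<noteq> {} \<and> invariant_set G \<phi> A}"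

lemma limit_set_subset:
  "compact A \<Longrightarrow> A \<subseteq> X \<Longrightarrow> A \<noteq> {} \<Longrightarrow> invariant_set G \<phi> A \<Longrightarrow> limit_set \<subseteq> A"
  by (auto simp: limit_set_def)

lemma limit_set_subset_X: "limit_set \<subseteq> X"
  by (simp add: limit_set_def)

lemma invariant_limit_set: "invariant_set G \<phi> limit_set"
  unfolding limit_set_def by (rule invariant_Inter) simp

lemma compact_limit_set: "compact limit_set"
  unfolding limit_set_def
  by (intro compact_Int_closed compact_X closed_Inter) (auto simp: compact_imp_closed)

lemma limit_set_nonempty:
  assumes con: "contracting B h"
  shows "limit_set \<noteq> {}"
  unfolding limit_set_def
proof (rule compact_imp_fip[OF compact_X])
  let ?F = "{A. compact A \<and> A \<subseteq> X \<and> A \<noteq> {} \<and> invariant_set G \<phi> A}"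
  fix F' assume "finite F'" "F' \<subseteq> ?F"
  then have "X \<inter> \<Inter>F' \<in> ?F"
  proof (induction F' rule: finite_induct)
    case empty
    then show ?case using compact_X X_nonempty surj_prop by (simp add: invariant_set_def)
  next
    case (insert A F')
    then have IH: "X \<inter> \<Inter>F' \<in> ?F" and A: "A \<in> ?F" by auto
    have "A \<inter> (X \<inter> \<Inter>F') \<noteq> {}"
      by (rule compact_invariant_sets_meet[OF con]) (use IH A in auto)
    moreover have "invariant_set G \<phi> (X \<inter> \<Inter>(insert A F'))"
      using insert.prems by (intro invariant_Inter) auto
    moreover have "compact (X \<inter> \<Inter>F')"
      using CollectD[OF IH] by (rule conjunct1)
    ultimately show ?case using A compact_Int[of A "X \<inter> \<Inter>F'"] by (simp add: Int_left_commute le_infI2)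
  qed
  then show "X \<inter> \<Inter>F' \<noteq> {}" by simp
qed (auto simp: compact_imp_closed)

lemma restricted_action_group_action:
  assumes K: "K \<subseteq> X" "invariant_set G \<phi> K"
  shows "group_action G K (restricted_action \<phi> K)"
proof -
  have inK: "\<phi> g x \<in> K" if "g \<in> carrier G" "x \<in> K" for g x
    using K(2) that unfolding invariant_set_def by blast
  have bij: "restricted_action \<phi> K g \<in> Bij K" if g: "g \<in> carrier G" for g
  proof -
    have "bij_betw (\<phi> g) K K"
      using K(2) g inj_on_subset[OF inj_prop[OF g] K(1)] by (simp add: bij_betw_def invariant_set_def)
    then show ?thesis
      by (simp add: Bij_def restricted_action_def bij_betw_restrict_eq)
  qed
  have "restricted_action \<phi> K (g \<otimes> g') = compose K (restricted_action \<phi> K g) (restricted_action \<phi> K g')"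
    if "g \<in> carrier G" "g' \<in> carrier G" for g g'
    unfolding restricted_action_def compose_def
    using that inK K(1) by (auto simp: fun_eq_iff restrict_def composition_rule)
  then have "restricted_action \<phi> K \<in> hom G (BijGroup K)"
    using bij by (auto simp: hom_def BijGroup_def)
  then show ?thesis
    using group_G group_BijGroup
    by (intro group_action.intro group_hom.intro group_hom_axioms.intro)
qed

lemma restricted_action_homeomorphisms:
  assumes K: "K \<subseteq> X" "invariant_set G \<phi> K"
  shows "acts_by_homeomorphisms G K (restricted_action \<phi> K)"
  unfolding acts_by_homeomorphisms_def
proof (intro conjI ballI)
  show "group_action G K (restricted_action \<phi> K)" using restricted_action_group_action[OF K] .
  fix g assume g: "g \<in> carrier G"
  have "homeomorphism K K (\<phi> g) (\<phi> (inv g))"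
    by (rule homeomorphism_of_subsets[OF homeomorphism_act[OF g]])
      (use K g in \<open>auto simp: invariant_set_def\<close>)
  then have "homeomorphism K K (restricted_action \<phi> K g) (\<phi> (inv g))"
    by (rule homeomorphism_cong) (auto simp: restricted_action_def)
  then show "\<exists>h. homeomorphism K K (restricted_action \<phi> K g) h" by blast
qed

lemma invariant_restricted_iff:
  "C \<subseteq> K \<Longrightarrow> invariant_set G (restricted_action \<phi> K) C \<longleftrightarrow> invariant_set G \<phi> C"
  unfolding invariant_set_def restricted_action_def
  by (intro ball_cong) (auto simp: subset_iff image_def)

lemma minimal_limit_set: "minimal_action G limit_set (restricted_action \<phi> limit_set)"
  unfolding minimal_action_def
proof (intro allI impI)
  fix C assume C: "closedin (top_of_set limit_set) C \<and> invariant_set G (restricted_action \<phi> limit_set) C"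
  then have "C \<subseteq> limit_set" "compact C"
    using closedin_imp_subset closedin_compact compact_limit_set by blast+
  moreover from this have "invariant_set G \<phi> C" using C invariant_restricted_iff by blast
  ultimately show "C = {} \<or> C = limit_set"
    using limit_set_subset[of C] limit_set_subset_X by blast
qed

text \<open>
  Of infinitely many disjoint translates of \<open>B\<close> some have small measure. Contracting the complement of
  such a translate moves all but a small part of the mass into a small ball with centre in \<open>K\<close>. A limit
  \<open>l\<close> of the centres, along a subsequence, is the point that carries the Dirac mass.
\<close>

theorem strongly_proximal_restricted:
  assumes con: "contracting B h"
    and K: "compact K" "K \<subseteq> X" "invariant_set G \<phi> K"
  shows "strongly_proximal G K (restricted_action \<phi> K)"
  unfolding strongly_proximal_def
proof
  fix \<mu> assume "\<mu> \<in> Prob K"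
  then have sets_\<mu>: "sets \<mu> = sets (borel_on K)" and prob_\<mu>: "prob_space \<mu>"
    by (auto simp: Prob_def space_prob_algebra)
  interpret prob_space \<mu> by (rule prob_\<mu>)
  have space_\<mu>: "space \<mu> = K"
    using sets_eq_imp_space_eq[OF sets_\<mu>] by (simp add: space_restrict_space)
  have inK: "\<phi> g x \<in> K" if "g \<in> carrier G" "x \<in> K" for g x
    using K(3) that unfolding invariant_set_def by blast
  have hG: "h n \<in> carrier G" for n using con by (simp add: contracting_def)
  define A where "A n = K \<inter> \<phi> (h n) ` B" for n
  have A_sets: "A n \<in> sets \<mu>" for n
  proof -
    have "openin (top_of_set X) (\<phi> (h n) ` B)"
      using con hG openin_act by (simp add: contracting_def)
    then obtain W where "open W" "\<phi> (h n) ` B = X \<inter> W" by (auto simp: openin_open)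
    then have "A n = K \<inter> W" using K(2) by (auto simp: A_def)
    then show ?thesis using \<open>open W\<close> by (auto simp: sets_\<mu> sets_restrict_space)
  qed
  have "disjoint_family A"
    using con unfolding disjoint_family_on_def A_def contracting_def by blast
  then have A_lim: "(\<lambda>n. prob (A n)) \<longlonglongrightarrow> 0"
    using A_sets by (intro measure_disjoint_family_tendsto_zero) auto
  \<comment> \<open>Bounds below 1, so that a set of measure less than \<open>\<epsilon> j\<close> cannot be all of \<open>K\<close>.\<close>
  define \<epsilon> where "\<epsilon> j = 1 / (real j + 2)" for j :: nat
  have \<epsilon>_pos: "\<epsilon> j > 0" "\<epsilon> j < 1" for j by (auto simp: \<epsilon>_def)
  have \<epsilon>_lim: "\<epsilon> \<longlonglongrightarrow> 0" unfolding \<epsilon>_def by real_asymp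
  have "\<exists>E k b. E \<in> sets \<mu> \<and> k \<in> carrier G \<and> b \<in> K \<and> prob E < \<epsilon> j \<and> (\<forall>x\<in>K - E. dist (\<phi> k x) b < \<epsilon> j)" for j
  proof -
    obtain n where n: "prob (A n) < \<epsilon> j"
      using order_tendstoD(2)[OF A_lim \<epsilon>_pos(1)] eventually_happens'[OF sequentially_bot] by blast
    obtain k where k: "k \<in> carrier G"
      "\<And>x y. x \<in> X - \<phi> (h n) ` B \<Longrightarrow> y \<in> X - \<phi> (h n) ` B \<Longrightarrow> dist (\<phi> k x) (\<phi> k y) < \<epsilon> j"
      using contract_off_translate[OF con \<epsilon>_pos(1)] by metis
    have "A n \<noteq> K"
      using n \<epsilon>_pos(2)[of j] prob_space space_\<mu> by auto
    then obtain y where y: "y \<in> K - A n" by (auto simp: A_def)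
    have "dist (\<phi> k x) (\<phi> k y) < \<epsilon> j" if "x \<in> K - A n" for x
      using that y K(2) by (intro k(2)) (auto simp: A_def)
    moreover have "\<phi> k y \<in> K" using inK[OF k(1)] y by simp
    ultimately show ?thesis
      using A_sets[of n] k(1) n by blast
  qed
  then obtain E k b where E: "\<And>j. E j \<in> sets \<mu>" "\<And>j. prob (E j) < \<epsilon> j" and k: "\<And>j. k j \<in> carrier G"
    and b: "\<And>j. b j \<in> K" "\<And>j x. x \<in> K - E j \<Longrightarrow> dist (\<phi> (k j) x) (b j) < \<epsilon> j"
    by metis
  obtain l r where l: "l \<in> K" and r: "strict_mono r" "(b \<circ> r) \<longlonglongrightarrow> l"
    using K(1) b(1) unfolding compact_eq_seq_compact_metric seq_compact_def by metis
  define \<nu> where "\<nu> j = Prob_action K (restricted_action \<phi> K) (k (r j)) \<mu>" for j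
  have meas: "restricted_action \<phi> K g \<in> measurable \<mu> (borel_on K)" if g: "g \<in> carrier G" for g
  proof -
    have "\<phi> g \<in> borel_measurable (borel_on K)"
      using continuous_on_subset[OF continuous_act[OF g] K(2)] by (rule borel_measurable_continuous_on_restrict)
    then have "\<phi> g \<in> measurable (borel_on K) (borel_on K)"
      using inK[OF g] by (intro measurable_restrict_space2) (auto simp: space_restrict_space)
    then have "restricted_action \<phi> K g \<in> measurable (borel_on K) (borel_on K)"
      by (rule measurable_cong[THEN iffD1, rotated]) (auto simp: restricted_action_def space_restrict_space)
    then show ?thesis using measurable_cong_sets[OF sets_\<mu> refl] by blast
  qed
  have \<nu>_Prob: "\<nu> j \<in> Prob K" for j
    unfolding \<nu>_def Prob_action_def Prob_def
    using prob_space_distr[OF meas[OF k]] by (simp add: space_prob_algebra)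
  have \<nu>_orbit: "\<nu> j \<in> orbit G (Prob_action K (restricted_action \<phi> K)) \<mu>" for j
    unfolding \<nu>_def orbit_def using k by blast
  have \<epsilon>r: "(\<lambda>j. \<epsilon> (r j)) \<longlonglongrightarrow> 0"
    using LIMSEQ_subseq_LIMSEQ[OF \<epsilon>_lim r(1)] by (simp add: comp_def)
  have conv: "(\<lambda>j. \<integral>x. f x \<partial>\<nu> j) \<longlonglongrightarrow> (\<integral>x. f x \<partial>return (borel_on K) l)"
    if f: "continuous_on K f" for f :: "'a \<Rightarrow> real"
  proof -
    have fm: "f \<in> borel_measurable (borel_on K)"
      using f by (rule borel_measurable_continuous_on_restrict)
    have "(\<integral>x. f x \<partial>return (borel_on K) l) = f l"
      using l fm by (intro integral_return) (auto simp: space_restrict_space)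
    moreover have int_\<nu>: "(\<integral>x. f x \<partial>\<nu> j) = (\<integral>x. f (restricted_action \<phi> K (k (r j)) x) \<partial>\<mu>)" for j
      unfolding \<nu>_def Prob_action_def by (rule integral_distr[OF meas[OF k] fm])
    moreover have "(\<lambda>j. \<integral>x. f (restricted_action \<phi> K (k (r j)) x) \<partial>\<mu>) \<longlonglongrightarrow> f l"
    proof (rule LIMSEQ_I)
      fix e :: real assume "e > 0"
      have "bounded (f ` K)"
        using compact_continuous_image[OF f K(1)] by (rule compact_imp_bounded)
      then obtain M where M: "\<And>x. x \<in> K \<Longrightarrow> \<bar>f x\<bar> \<le> M" "M > 0"
        unfolding bounded_pos by auto
      \<comment> \<open>Half of \<open>e\<close> is spent on the ball where \<open>f\<close> is close to \<open>f l\<close>, the other half on the exceptional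
        set, where \<open>f\<close> differs from \<open>f l\<close> by at most \<open>2 * M\<close>.\<close>
      obtain d where d: "d > 0" "\<And>x. x \<in> K \<Longrightarrow> dist x l < d \<Longrightarrow> \<bar>f x - f l\<bar> < e/2"
        using f l \<open>e > 0\<close> unfolding continuous_on_iff dist_real_def by (metis half_gt_zero)
      have "eventually (\<lambda>j. dist (b (r j)) l < d/2) sequentially"
        using tendstoD[OF r(2), of "d/2"] d(1) by (simp add: comp_def)
      moreover have "eventually (\<lambda>j. \<epsilon> (r j) < d/2) sequentially"
        using order_tendstoD(2)[OF \<epsilon>r, of "d/2"] d(1) by simp
      moreover have "eventually (\<lambda>j. \<epsilon> (r j) < e / (4 * M)) sequentially"
        using order_tendstoD(2)[OF \<epsilon>r, of "e / (4 * M)"] \<open>e > 0\<close> M(2) by simp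
      ultimately have "eventually (\<lambda>j. \<bar>(\<integral>x. f (restricted_action \<phi> K (k (r j)) x) \<partial>\<mu>) - f l\<bar> < e) sequentially"
      proof eventually_elim
        case (elim j)
        have "\<bar>(\<integral>x. f (restricted_action \<phi> K (k (r j)) x) \<partial>\<mu>) - f l\<bar> \<le> e/2 + (2 * M) * prob (E (r j))"
        proof (rule abs_integral_minus_const_le)
          show "(\<lambda>x. f (restricted_action \<phi> K (k (r j)) x)) \<in> borel_measurable \<mu>"
            using measurable_compose[OF meas[OF k] fm] .
          fix x assume x: "x \<in> space \<mu>"
          then have kx: "restricted_action \<phi> K (k (r j)) x = \<phi> (k (r j)) x" "\<phi> (k (r j)) x \<in> K"
            using space_\<mu> inK k by (auto simp: restricted_action_def)
          show "\<bar>f (restricted_action \<phi> K (k (r j)) x) - f l\<bar> \<le> 2 * M"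
            using M(1)[OF kx(2)] M(1)[OF l] unfolding kx(1) by linarith
        next
          fix x assume x: "x \<in> space \<mu> - E (r j)"
          then have kx: "restricted_action \<phi> K (k (r j)) x = \<phi> (k (r j)) x" "\<phi> (k (r j)) x \<in> K"
            using space_\<mu> inK k by (auto simp: restricted_action_def)
          have "dist (\<phi> (k (r j)) x) (b (r j)) < d/2"
            using b(2)[of x "r j"] x space_\<mu> elim(2) by simp
          then have "dist (\<phi> (k (r j)) x) l < d"
            using elim(1) dist_triangle[of "\<phi> (k (r j)) x" l "b (r j)"] by linarith
          then show "\<bar>f (restricted_action \<phi> K (k (r j)) x) - f l\<bar> \<le> e/2"
            using d(2)[OF kx(2)] unfolding kx(1) by simp
        qed (use E \<open>e > 0\<close> M in auto)
        also have "\<dots> < e"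
        proof -
          have "prob (E (r j)) < e / (4 * M)" using E(2)[of "r j"] elim(3) by simp
          then have "prob (E (r j)) * (4 * M) < e"
            using M(2) by (simp add: pos_less_divide_eq)
          then show ?thesis by (simp add: mult.commute[of "prob _"])
        qed
        finally show ?case .
      qed
      then show "\<exists>no. \<forall>j\<ge>no. norm ((\<integral>x. f (restricted_action \<phi> K (k (r j)) x) \<partial>\<mu>) - f l) < e"
        by (simp add: eventually_sequentially)
    qed
    ultimately show ?thesis by simp
  qed
  have dirac: "return (borel_on K) l \<in> Prob K"
    unfolding Prob_def using l
    by (auto simp: space_prob_algebra space_restrict_space intro!: prob_space_return)
  have "topspace (weak_star_topology K) = Prob K"
  proof -
    have "Prob K \<in> {{\<mu> \<in> Prob K. (\<integral>x. f x \<partial>\<mu>) \<in> U} | (f :: 'a \<Rightarrow> real) U. continuous_on K f \<and> open U}"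
      by (rule CollectI, rule exI[of _ "\<lambda>_. 0"], rule exI[of _ UNIV]) auto
    then show ?thesis unfolding weak_star_topology_def topology_generated_by_topspace by blast
  qed
  then have "return (borel_on K) l \<in> (weak_star_topology K) closure_of (orbit G (Prob_action K (restricted_action \<phi> K)) \<mu>)"
    unfolding in_closure_of
  proof (intro conjI allI impI)
    fix T assume T: "return (borel_on K) l \<in> T \<and> openin (weak_star_topology K) T"
    have "eventually (\<lambda>j. \<nu> j \<in> T) sequentially"
      by (rule eventually_in_weak_star_open[of K T "return (borel_on K) l"]) (use T \<nu>_Prob conv in auto)
    then show "\<exists>y. y \<in> orbit G (Prob_action K (restricted_action \<phi> K)) \<mu> \<and> y \<in> T"
      using \<nu>_orbit eventually_happens'[OF sequentially_bot] by blast
  qed (use dirac in simp)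
  then show "\<exists>y\<in>K. return (borel_on K) y \<in> (weak_star_topology K) closure_of (orbit G (Prob_action K (restricted_action \<phi> K)) \<mu>)"
    using l by blast
qed

text \<open>
  A boundary \<open>K\<close> is a non-empty compact invariant set, so it contains the limit set, and its minimality
  forces equality.
\<close>

theorem unique_boundary:
  assumes "\<not> elementary_action G X \<phi>"
  shows "\<exists>!K. compact_G_set G X \<phi> K \<and> G_boundary G K (restricted_action \<phi> K)"
proof
  obtain B h where con: "contracting B h" using non_elementary_contracting[OF assms] .
  show "compact_G_set G X \<phi> limit_set \<and> G_boundary G limit_set (restricted_action \<phi> limit_set)"
    unfolding compact_G_set_def G_boundary_def
    using compact_limit_set limit_set_subset_X invariant_limit_set limit_set_nonempty[OF con]
      restricted_action_homeomorphisms minimal_limit_set strongly_proximal_restricted[OF con]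
    by auto
  fix K assume K: "compact_G_set G X \<phi> K \<and> G_boundary G K (restricted_action \<phi> K)"
  then have "limit_set \<subseteq> K"
    by (intro limit_set_subset) (auto simp: compact_G_set_def G_boundary_def)
  moreover from this have "closedin (top_of_set K) limit_set"
    using compact_limit_set by (simp add: closed_subset compact_imp_closed)
  moreover have "invariant_set G (restricted_action \<phi> K) limit_set"
    using invariant_restricted_iff[OF \<open>limit_set \<subseteq> K\<close>] invariant_limit_set by simp
  ultimately show "K = limit_set"
    using K limit_set_nonempty[OF con] unfolding G_boundary_def minimal_action_def by blast
qed

end

theorem theorem1p8:
  fixes G :: "('g, 'm) monoid_scheme"
    and X :: "'a::metric_space set"
    and \<phi> :: "'g \<Rightarrow> 'a \<Rightarrow> 'a"
  assumes "group G"
    and "dendrite X"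
    and "acts_by_homeomorphisms G X \<phi>"
    and "\<not> elementary_action G X \<phi>"
  shows "\<exists>!K. compact_G_set G X \<phi> K \<and> G_boundary G K (restricted_action \<phi> K)"
proof -
  have act: "group_action G X \<phi>"
    using assms(3) by (simp add: acts_by_homeomorphisms_def)
  have cont: "continuous_on X (\<phi> g)" if "g \<in> carrier G" for g
    using assms(3) that unfolding acts_by_homeomorphisms_def homeomorphism_def by blast
  have tree: "tree_continuum X"
    using assms(2) dendrite_connected_Int[OF assms(2)]
    by (intro tree_continuum.intro) (auto simp: dendrite_def continuum_def)
  interpret tree_continuum_action X G \<phi>
    by (intro tree_continuum_action.intro tree act tree_continuum_action_axioms.intro cont)
  show ?thesis
    by (rule unique_boundary[OF assms(4)])
qed

end
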